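(* Let $A$ be a $C^*$-algebra, $N$ a right Hilbert $C^*$-module over $A$, and $M\subset N$ a closed submodule. If $M$ is essential in $N$, then $M$ is functionally thick in $N$; and if $M$ is functionally thick in $N$, then $M$ is thick in $N$. Moreover, all three properties are different: there exist a $C^*$-algebra $A$, a Hilbert $C^*$-module $N$ over $A$ and a closed submodule $M\subset N$ that is functionally thick but not essential in $N$, and there exist a $C^*$-algebra $A$, a Hilbert $C^*$-module $N$ over $A$ and a closed submodule $M\subset N$ that is thick but not functionally thick in $N$.
   Context: Hilbert $C^*$-modules over $A$ are right modules with $A$-valued inner product $\langle\cdot,\cdot\rangle$ that is conjugate-linear in the first and $A$-linear in the second variable. A functional on a Hilbert $C^*$-module $N$ is a bounded anti-linear map $f:N\to A$ such that $f(na)=a^*f(n)$ for all $n\in N$, $a\in A$. For a closed submodule $M\subset N$: $M$ is essential in $N$ if $M\cap K\neq 0$ for every (not necessarily closed) non-zero submodule $K\subset N$; $M$ is thick in $N$ if $M^\perp=\{n\in N:\langle n,m\rangle=0\ \forall m\in M\}=0$; $M$ is functionally thick in $N$ if, for every functional $f$ on $N$, $f|_M=0$ implies $f=0$. *)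

theory Defs
  imports "HOL-Analysis.Analysis" "HOL-Algebra.Module"
begin

text \<open>
  Everything is carrier-based, so that one can quantify over all \<open>C\<^sup>*\<close>-algebras and all
  Hilbert modules on given types. Vector spaces over the complex numbers are HOL-Algebra modules
  over the following ring.
\<close>

definition complex_ring :: "complex ring" where
  "complex_ring = \<lparr>carrier = UNIV, mult = (*), one = 1, zero = 0, add = (+)\<rparr>"

abbreviation complex_vector_space :: "(complex, 'v, 'm) module_scheme \<Rightarrow> bool" where
  "complex_vector_space V \<equiv> Module.module complex_ring V"

definition banach_norm :: "(complex, 'v, 'm) module_scheme \<Rightarrow> ('v \<Rightarrow> real) \<Rightarrow> bool" where
  "banach_norm V nm \<longleftrightarrow>
     (\<forall>x\<in>carrier V. nm x \<ge> 0 \<and> (nm x = 0 \<longleftrightarrow> x = \<zero>\<^bsub>V\<^esub>)) \<and>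
     (\<forall>c. \<forall>x\<in>carrier V. nm (c \<odot>\<^bsub>V\<^esub> x) = cmod c * nm x) \<and>
     (\<forall>x\<in>carrier V. \<forall>y\<in>carrier V. nm (x \<oplus>\<^bsub>V\<^esub> y) \<le> nm x + nm y) \<and>
     Metric_space.mcomplete (carrier V) (\<lambda>x y. nm (x \<ominus>\<^bsub>V\<^esub> y))"

text \<open>
  The record \<^typ>\<open>(complex, 'a) module\<close> supplies carrier, addition, zero, multiplication and scalar
  multiplication. Its field \<^const>\<open>one\<close> is never constrained: algebras need not be unital.
\<close>

record 'a cstar_alg = "(complex, 'a) module" +
  star :: "'a \<Rightarrow> 'a"
  cnorm :: "'a \<Rightarrow> real"

locale cstar_algebra =
  fixes A :: "('a, 'm) cstar_alg_scheme" (structure)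
  assumes vector_space: "complex_vector_space A"
    and mult_closed: "\<lbrakk>a \<in> carrier A; b \<in> carrier A\<rbrakk> \<Longrightarrow> a \<otimes> b \<in> carrier A"
    and mult_assoc: "\<lbrakk>a \<in> carrier A; b \<in> carrier A; c \<in> carrier A\<rbrakk>
      \<Longrightarrow> (a \<otimes> b) \<otimes> c = a \<otimes> (b \<otimes> c)"
    and mult_add_left: "\<lbrakk>a \<in> carrier A; b \<in> carrier A; c \<in> carrier A\<rbrakk>
      \<Longrightarrow> (a \<oplus> b) \<otimes> c = a \<otimes> c \<oplus> b \<otimes> c"
    and mult_add_right: "\<lbrakk>a \<in> carrier A; b \<in> carrier A; c \<in> carrier A\<rbrakk>
      \<Longrightarrow> a \<otimes> (b \<oplus> c) = a \<otimes> b \<oplus> a \<otimes> c"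
    and mult_smult_left: "\<lbrakk>a \<in> carrier A; b \<in> carrier A\<rbrakk>
      \<Longrightarrow> (t \<odot> a) \<otimes> b = t \<odot> (a \<otimes> b)"
    and mult_smult_right: "\<lbrakk>a \<in> carrier A; b \<in> carrier A\<rbrakk>
      \<Longrightarrow> a \<otimes> (t \<odot> b) = t \<odot> (a \<otimes> b)"
    and star_closed: "a \<in> carrier A \<Longrightarrow> star A a \<in> carrier A"
    and star_star: "a \<in> carrier A \<Longrightarrow> star A (star A a) = a"
    and star_add: "\<lbrakk>a \<in> carrier A; b \<in> carrier A\<rbrakk>
      \<Longrightarrow> star A (a \<oplus> b) = star A a \<oplus> star A b"
    and star_smult: "a \<in> carrier A \<Longrightarrow> star A (t \<odot> a) = cnj t \<odot> star A a"
    and star_mult: "\<lbrakk>a \<in> carrier A; b \<in> carrier A\<rbrakk>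
      \<Longrightarrow> star A (a \<otimes> b) = star A b \<otimes> star A a"
    and banach: "banach_norm A (cnorm A)"
    and norm_mult: "\<lbrakk>a \<in> carrier A; b \<in> carrier A\<rbrakk>
      \<Longrightarrow> cnorm A (a \<otimes> b) \<le> cnorm A a * cnorm A b"
    and cstar_identity: "a \<in> carrier A \<Longrightarrow> cnorm A (star A a \<otimes> a) = (cnorm A a)\<^sup>2"

text \<open>Positivity in the sense \<open>a = b\<^sup>*b\<close>, which needs no unitization or spectrum.\<close>

definition cstar_positive :: "('a, 'm) cstar_alg_scheme \<Rightarrow> 'a \<Rightarrow> bool" where
  "cstar_positive A a \<longleftrightarrow> (\<exists>b\<in>carrier A. a = star A b \<otimes>\<^bsub>A\<^esub> b)"

text \<open>Of the inherited fields, multiplication and unit of a Hilbert module are unused.\<close>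

record ('a, 'n) hilbert_mod = "(complex, 'n) module" +
  act :: "'n \<Rightarrow> 'a \<Rightarrow> 'n"
  ip :: "'n \<Rightarrow> 'n \<Rightarrow> 'a"

definition mod_norm ::
  "('a, 'm) cstar_alg_scheme \<Rightarrow> ('a, 'n, 'k) hilbert_mod_scheme \<Rightarrow> 'n \<Rightarrow> real" where
  "mod_norm A N x = sqrt (cnorm A (ip N x x))"

definition mod_topology ::
  "('a, 'm) cstar_alg_scheme \<Rightarrow> ('a, 'n, 'k) hilbert_mod_scheme \<Rightarrow> 'n topology" where
  "mod_topology A N = Metric_space.mtopology (carrier N) (\<lambda>x y. mod_norm A N (x \<ominus>\<^bsub>N\<^esub> y))"

text \<open>
  That \<^const>\<open>mod_norm\<close> is a norm (via the Cauchy-Schwarz inequality) follows from the other axioms;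
  it is part of the last axiom only because completeness is expressed as being a Banach space.
\<close>

locale hilbert_module = cstar_algebra A
  for A :: "('a, 'm) cstar_alg_scheme" +
  fixes N :: "('a, 'n, 'k) hilbert_mod_scheme"
  assumes mod_vector_space: "complex_vector_space N"
    and act_closed: "\<lbrakk>x \<in> carrier N; a \<in> carrier A\<rbrakk> \<Longrightarrow> act N x a \<in> carrier N"
    and act_mult: "\<lbrakk>x \<in> carrier N; a \<in> carrier A; b \<in> carrier A\<rbrakk>
      \<Longrightarrow> act N x (a \<otimes>\<^bsub>A\<^esub> b) = act N (act N x a) b"
    and act_add_left: "\<lbrakk>x \<in> carrier N; y \<in> carrier N; a \<in> carrier A\<rbrakk>
      \<Longrightarrow> act N (x \<oplus>\<^bsub>N\<^esub> y) a = act N x a \<oplus>\<^bsub>N\<^esub> act N y a"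
    and act_add_right: "\<lbrakk>x \<in> carrier N; a \<in> carrier A; b \<in> carrier A\<rbrakk>
      \<Longrightarrow> act N x (a \<oplus>\<^bsub>A\<^esub> b) = act N x a \<oplus>\<^bsub>N\<^esub> act N x b"
    and act_smult_left: "\<lbrakk>x \<in> carrier N; a \<in> carrier A\<rbrakk>
      \<Longrightarrow> act N (t \<odot>\<^bsub>N\<^esub> x) a = t \<odot>\<^bsub>N\<^esub> act N x a"
    and act_smult_right: "\<lbrakk>x \<in> carrier N; a \<in> carrier A\<rbrakk>
      \<Longrightarrow> act N x (t \<odot>\<^bsub>A\<^esub> a) = t \<odot>\<^bsub>N\<^esub> act N x a"
    and ip_closed: "\<lbrakk>x \<in> carrier N; y \<in> carrier N\<rbrakk> \<Longrightarrow> ip N x y \<in> carrier A"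
    and ip_add_right: "\<lbrakk>x \<in> carrier N; y \<in> carrier N; z \<in> carrier N\<rbrakk>
      \<Longrightarrow> ip N x (y \<oplus>\<^bsub>N\<^esub> z) = ip N x y \<oplus>\<^bsub>A\<^esub> ip N x z"
    and ip_smult_right: "\<lbrakk>x \<in> carrier N; y \<in> carrier N\<rbrakk>
      \<Longrightarrow> ip N x (t \<odot>\<^bsub>N\<^esub> y) = t \<odot>\<^bsub>A\<^esub> ip N x y"
    and ip_act_right: "\<lbrakk>x \<in> carrier N; y \<in> carrier N; a \<in> carrier A\<rbrakk>
      \<Longrightarrow> ip N x (act N y a) = ip N x y \<otimes>\<^bsub>A\<^esub> a"
    and ip_star: "\<lbrakk>x \<in> carrier N; y \<in> carrier N\<rbrakk> \<Longrightarrow> star A (ip N x y) = ip N y x"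
    and ip_positive: "x \<in> carrier N \<Longrightarrow> cstar_positive A (ip N x x)"
    and ip_definite: "\<lbrakk>x \<in> carrier N; ip N x x = \<zero>\<^bsub>A\<^esub>\<rbrakk> \<Longrightarrow> x = \<zero>\<^bsub>N\<^esub>"
    and mod_banach: "banach_norm N (mod_norm A N)"

text \<open>Algebraic submodule; no closedness required.\<close>

definition mod_submodule ::
  "('a, 'm) cstar_alg_scheme \<Rightarrow> ('a, 'n, 'k) hilbert_mod_scheme \<Rightarrow> 'n set \<Rightarrow> bool" where
  "mod_submodule A N K \<longleftrightarrow>
     submodule K complex_ring N \<and> (\<forall>x\<in>K. \<forall>a\<in>carrier A. act N x a \<in> K)"

definition closed_submodule ::
  "('a, 'm) cstar_alg_scheme \<Rightarrow> ('a, 'n, 'k) hilbert_mod_scheme \<Rightarrow> 'n set \<Rightarrow> bool" where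
  "closed_submodule A N M \<longleftrightarrow> mod_submodule A N M \<and> closedin (mod_topology A N) M"

definition mod_functional ::
  "('a, 'm) cstar_alg_scheme \<Rightarrow> ('a, 'n, 'k) hilbert_mod_scheme \<Rightarrow> ('n \<Rightarrow> 'a) \<Rightarrow> bool" where
  "mod_functional A N f \<longleftrightarrow>
     (\<forall>x\<in>carrier N. f x \<in> carrier A) \<and>
     (\<forall>x\<in>carrier N. \<forall>y\<in>carrier N. f (x \<oplus>\<^bsub>N\<^esub> y) = f x \<oplus>\<^bsub>A\<^esub> f y) \<and>
     (\<forall>t. \<forall>x\<in>carrier N. f (t \<odot>\<^bsub>N\<^esub> x) = cnj t \<odot>\<^bsub>A\<^esub> f x) \<and>
     (\<forall>x\<in>carrier N. \<forall>a\<in>carrier A. f (act N x a) = star A a \<otimes>\<^bsub>A\<^esub> f x) \<and>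
     (\<exists>C. \<forall>x\<in>carrier N. cnorm A (f x) \<le> C * mod_norm A N x)"

definition essential ::
  "('a, 'm) cstar_alg_scheme \<Rightarrow> ('a, 'n, 'k) hilbert_mod_scheme \<Rightarrow> 'n set \<Rightarrow> bool" where
  "essential A N M \<longleftrightarrow>
     (\<forall>K. mod_submodule A N K \<and> K \<noteq> {\<zero>\<^bsub>N\<^esub>} \<longrightarrow> M \<inter> K \<noteq> {\<zero>\<^bsub>N\<^esub>})"

definition ortho_compl ::
  "('a, 'm) cstar_alg_scheme \<Rightarrow> ('a, 'n, 'k) hilbert_mod_scheme \<Rightarrow> 'n set \<Rightarrow> 'n set" where
  "ortho_compl A N M = {x \<in> carrier N. \<forall>m\<in>M. ip N x m = \<zero>\<^bsub>A\<^esub>}"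

definition thick ::
  "('a, 'm) cstar_alg_scheme \<Rightarrow> ('a, 'n, 'k) hilbert_mod_scheme \<Rightarrow> 'n set \<Rightarrow> bool" where
  "thick A N M \<longleftrightarrow> ortho_compl A N M = {\<zero>\<^bsub>N\<^esub>}"

definition functionally_thick ::
  "('a, 'm) cstar_alg_scheme \<Rightarrow> ('a, 'n, 'k) hilbert_mod_scheme \<Rightarrow> 'n set \<Rightarrow> bool" where
  "functionally_thick A N M \<longleftrightarrow>
     (\<forall>f. mod_functional A N f \<and> (\<forall>m\<in>M. f m = \<zero>\<^bsub>A\<^esub>) \<longrightarrow> (\<forall>x\<in>carrier N. f x = \<zero>\<^bsub>A\<^esub>))"

end

theory Submission
  imports Defs "HOL-Library.Function_Algebras"
begin

text \<open>
  \<^bold>\<open>Essential implies functionally thick.\<close> If a functional \<open>f\<close> vanishes on \<open>M\<close> but \<open>f x \<noteq> 0\<close>, then \<open>f\<close> is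
  injective on the algebraic submodule \<open>K = {x \<cdot> (f(x) c) | c \<in> A}\<close>: with \<open>b = f(x) c\<close> one has
  \<open>f(x b) c = b\<^sup>* f(x) c = b\<^sup>* b\<close>, so \<open>f(x b) = 0\<close> forces \<open>b = 0\<close> (lemma
  \<open>functional_inj_on_multiples\<close>). Hence \<open>M \<inter> K = 0\<close>, although \<open>K \<noteq> 0\<close>.

  \<^bold>\<open>Functionally thick implies thick.\<close> If \<open>x\<close> is orthogonal to \<open>M\<close>, then \<open>n \<mapsto> \<langle>n, x\<rangle>\<close> is a functional
  that vanishes on \<open>M\<close>, so \<open>\<langle>x, x\<rangle> = 0\<close>. Its boundedness comes from polarization
  (lemma \<open>cnorm_ip_le_polarization\<close>).

  \<^bold>\<open>The counterexamples\<close> both live in the standard module \<open>N = \<ell>\<^sup>2(A)\<close> over the algebra \<open>A\<close> of bounded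
  continuous functions on the real line: sequences \<open>(x\<^sub>k)\<close> in \<open>A\<close> for which \<open>\<Sum>\<^sub>k \<bar>x\<^sub>k(t)\<bar>\<^sup>2\<close> converges
  uniformly in \<open>t\<close>. Let \<open>e\<^sub>k\<close> be its coordinate elements and let \<open>q\<^sub>0, q\<^sub>1, \<dots>\<close> enumerate the rationals.
  Finite sequences are dense in \<open>N\<close>, so a functional is determined by its values on the \<open>e\<^sub>k\<close>
  (lemma \<open>functional_expansion\<close>).

  For \<open>M = {x. x\<^bsub>k+1\<^esub>(q\<^sub>k) = 2\<^sup>-\<^sup>k x\<^sub>0(q\<^sub>k) for all k}\<close> and \<open>K = e\<^sub>0 A\<close>, an element of \<open>M \<inter> K\<close> has a first
  coordinate that vanishes at every rational, so \<open>M \<inter> K = 0\<close> and \<open>M\<close> is not essential. A functional that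
  kills \<open>M\<close> kills \<open>e\<^bsub>k+1\<^esub> a\<close> whenever \<open>a(q\<^sub>k) = 0\<close>; by continuity its value at \<open>e\<^bsub>k+1\<^esub>\<close>, which can only
  be nonzero at the point \<open>q\<^sub>k\<close>, is zero. As \<open>e\<^sub>0 + \<Sum>\<^sub>k 2\<^sup>-\<^sup>k e\<^bsub>k+1\<^esub>\<close> belongs to \<open>M\<close>, it kills \<open>e\<^sub>0\<close>, too.
  So \<open>M\<close> is functionally thick.

  For the second example take a bounded sequence \<open>v = (1, v\<^sub>1, v\<^sub>2, \<dots>)\<close> in \<open>A\<close> for which \<open>\<Sum>\<^sub>k v\<^sub>k\<^sup>2\<close> is
  bounded but converges uniformly on no interval; as a map from the real line to \<open>\<ell>\<^sup>2\<close> it is weakly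
  continuous, but norm-continuous on no interval. It defines a functional \<open>f\<close> on \<open>N\<close>, nonzero at \<open>e\<^sub>0\<close>, so
  \<open>M = ker f\<close> is not functionally thick. An element \<open>y\<close> orthogonal to \<open>M\<close> is orthogonal to every
  \<open>e\<^sub>k - e\<^sub>0 v\<^sub>k\<close>, that is, \<open>y = y\<^sub>0 v\<close>. If \<open>y\<^sub>0\<close> were nonzero at a point, it would be bounded away from zero
  on an interval, on which \<open>\<Sum>\<^sub>k v\<^sub>k\<^sup>2\<close> would then converge uniformly (lemma
  \<open>multiple_of_weak_section_zero\<close>). So \<open>y = 0\<close>, and \<open>M\<close> is thick.
\<close>

section \<open>The two implications\<close>

lemma complex_ring_simps [simp]:
  "carrier complex_ring = UNIV" "mult complex_ring = (*)" "one complex_ring = 1"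
  "zero complex_ring = 0" "add complex_ring = (+)"
  by (simp_all add: complex_ring_def)

lemma submodule_complexI:
  assumes "complex_vector_space V" and "H \<subseteq> carrier V" and "\<zero>\<^bsub>V\<^esub> \<in> H"
    and "\<And>x y. \<lbrakk>x \<in> H; y \<in> H\<rbrakk> \<Longrightarrow> x \<oplus>\<^bsub>V\<^esub> y \<in> H"
    and smult: "\<And>t x. x \<in> H \<Longrightarrow> t \<odot>\<^bsub>V\<^esub> x \<in> H"
  shows "submodule H complex_ring V"
proof -
  interpret Module.module complex_ring V by (rule assms)
  have "\<ominus>\<^bsub>V\<^esub> x \<in> H" if "x \<in> H" for x
  proof -
    have "(\<ominus>\<^bsub>complex_ring\<^esub> 1) \<odot>\<^bsub>V\<^esub> x = \<ominus>\<^bsub>V\<^esub> (1 \<odot>\<^bsub>V\<^esub> x)"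
      using that assms(2) by (intro smult_l_minus) auto
    then show ?thesis
      using smult[OF that] smult_one[of x] that assms(2) by (metis complex_ring_simps(3) subsetD)
  qed
  then show ?thesis
    using assms by (intro submoduleI) auto
qed

context cstar_algebra
begin

sublocale vs: Module.module complex_ring A
  by (rule vector_space)

lemma norm_nonneg: "a \<in> carrier A \<Longrightarrow> cnorm A a \<ge> 0"
  and norm_eq_0: "a \<in> carrier A \<Longrightarrow> cnorm A a = 0 \<longleftrightarrow> a = \<zero>"
  and norm_smult: "a \<in> carrier A \<Longrightarrow> cnorm A (c \<odot> a) = cmod c * cnorm A a"
  and norm_add: "\<lbrakk>a \<in> carrier A; b \<in> carrier A\<rbrakk> \<Longrightarrow> cnorm A (a \<oplus> b) \<le> cnorm A a + cnorm A b"
  using banach by (auto simp: banach_norm_def)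

lemma smult_0: "a \<in> carrier A \<Longrightarrow> 0 \<odot> a = \<zero>"
  using vs.smult_l_null by simp

lemma mult_zero_right: "a \<in> carrier A \<Longrightarrow> a \<otimes> \<zero> = \<zero>"
  by (metis vs.zero_closed mult_closed mult_smult_right smult_0)

lemma star_zero: "star A \<zero> = \<zero>"
  by (metis vs.zero_closed star_closed star_smult smult_0 complex_cnj_zero)

lemma star_mult_eq_0D:
  assumes "a \<in> carrier A" "star A a \<otimes> a = \<zero>"
  shows "a = \<zero>"
  using cstar_identity[of a] assms norm_eq_0[of a] norm_eq_0[OF vs.zero_closed] by simp

end

context hilbert_module
begin

sublocale mvs: Module.module complex_ring N
  by (rule mod_vector_space)

lemma mod_norm_nonneg: "x \<in> carrier N \<Longrightarrow> mod_norm A N x \<ge> 0"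
  and mod_norm_eq_0: "x \<in> carrier N \<Longrightarrow> mod_norm A N x = 0 \<longleftrightarrow> x = \<zero>\<^bsub>N\<^esub>"
  and mod_norm_smult: "x \<in> carrier N \<Longrightarrow> mod_norm A N (c \<odot>\<^bsub>N\<^esub> x) = cmod c * mod_norm A N x"
  and mod_norm_add: "\<lbrakk>x \<in> carrier N; y \<in> carrier N\<rbrakk>
    \<Longrightarrow> mod_norm A N (x \<oplus>\<^bsub>N\<^esub> y) \<le> mod_norm A N x + mod_norm A N y"
  using mod_banach by (auto simp: banach_norm_def)

lemma cnorm_ip_self: "x \<in> carrier N \<Longrightarrow> cnorm A (ip N x x) = (mod_norm A N x)\<^sup>2"
  using norm_nonneg[OF ip_closed] by (simp add: mod_norm_def)

lemma mod_smult_0: "x \<in> carrier N \<Longrightarrow> 0 \<odot>\<^bsub>N\<^esub> x = \<zero>\<^bsub>N\<^esub>"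
  using mvs.smult_l_null by simp

lemma act_zero: "x \<in> carrier N \<Longrightarrow> act N x \<zero>\<^bsub>A\<^esub> = \<zero>\<^bsub>N\<^esub>"
  by (metis vs.zero_closed smult_0 act_smult_right act_closed mod_smult_0)

lemma mod_submoduleD:
  assumes "mod_submodule A N M"
  shows "M \<subseteq> carrier N" "\<zero>\<^bsub>N\<^esub> \<in> M"
proof -
  have "subgroup M (add_monoid N)"
    using assms by (simp add: mod_submodule_def submodule_def)
  then show "M \<subseteq> carrier N" "\<zero>\<^bsub>N\<^esub> \<in> M"
    using subgroup.subset subgroup.one_closed by fastforce+
qed

lemma functional_zero:
  assumes "mod_functional A N f"
  shows "f \<zero>\<^bsub>N\<^esub> = \<zero>\<^bsub>A\<^esub>"
proof -
  have "f \<zero>\<^bsub>N\<^esub> \<in> carrier A" "f (0 \<odot>\<^bsub>N\<^esub> \<zero>\<^bsub>N\<^esub>) = cnj 0 \<odot>\<^bsub>A\<^esub> f \<zero>\<^bsub>N\<^esub>"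
    using assms unfolding mod_functional_def by blast+
  then show ?thesis
    by (simp add: smult_0 mod_smult_0)
qed

text \<open>
  With \<open>b = f(x) c\<close> one has \<open>f(x b) = b\<^sup>* f(x)\<close> and hence \<open>f(x b) c = b\<^sup>* b\<close>; by the
  \<open>C\<^sup>*\<close>-identity \<open>f(x b) = 0\<close> forces \<open>b = 0\<close>.
\<close>

lemma functional_inj_on_multiples:
  assumes f: "mod_functional A N f" and x: "x \<in> carrier N" and c: "c \<in> carrier A"
    and zero: "f (act N x (f x \<otimes>\<^bsub>A\<^esub> c)) = \<zero>\<^bsub>A\<^esub>"
  shows "f x \<otimes>\<^bsub>A\<^esub> c = \<zero>\<^bsub>A\<^esub>"
proof (rule star_mult_eq_0D)
  have fx: "f x \<in> carrier A"
    using f x by (simp add: mod_functional_def)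
  show b: "f x \<otimes>\<^bsub>A\<^esub> c \<in> carrier A"
    by (simp add: fx c mult_closed)
  then have "star A (f x \<otimes>\<^bsub>A\<^esub> c) \<otimes>\<^bsub>A\<^esub> f x = \<zero>\<^bsub>A\<^esub>"
    using f x zero by (simp add: mod_functional_def)
  moreover have "\<zero>\<^bsub>A\<^esub> \<otimes>\<^bsub>A\<^esub> c = \<zero>\<^bsub>A\<^esub>"
    by (metis c vs.zero_closed mult_closed mult_smult_left smult_0)
  ultimately show "star A (f x \<otimes>\<^bsub>A\<^esub> c) \<otimes>\<^bsub>A\<^esub> (f x \<otimes>\<^bsub>A\<^esub> c) = \<zero>\<^bsub>A\<^esub>"
    using mult_assoc[OF star_closed[OF b] fx c] by simp
qed

lemma mod_submodule_multiples:
  assumes x: "x \<in> carrier N" and a: "a \<in> carrier A"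
  shows "mod_submodule A N ((\<lambda>c. act N x (a \<otimes>\<^bsub>A\<^esub> c)) ` carrier A)" (is "mod_submodule A N ?K")
  unfolding mod_submodule_def
proof (intro conjI ballI)
  show "submodule ?K complex_ring N"
  proof (rule submodule_complexI[OF mod_vector_space])
    show "?K \<subseteq> carrier N"
      using x a act_closed mult_closed by auto
    show "\<zero>\<^bsub>N\<^esub> \<in> ?K"
      using act_zero[OF x] mult_zero_right[OF a] vs.zero_closed by force
  next
    fix y z assume "y \<in> ?K" "z \<in> ?K"
    then obtain c d where "c \<in> carrier A" "y = act N x (a \<otimes>\<^bsub>A\<^esub> c)" "d \<in> carrier A" "z = act N x (a \<otimes>\<^bsub>A\<^esub> d)"
      by auto
    then have "y \<oplus>\<^bsub>N\<^esub> z = act N x (a \<otimes>\<^bsub>A\<^esub> (c \<oplus>\<^bsub>A\<^esub> d))" "c \<oplus>\<^bsub>A\<^esub> d \<in> carrier A"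
      using x a act_add_right mult_closed mult_add_right vs.add.m_closed by auto
    then show "y \<oplus>\<^bsub>N\<^esub> z \<in> ?K"
      by blast
  next
    fix t y assume "y \<in> ?K"
    then obtain c where "c \<in> carrier A" "y = act N x (a \<otimes>\<^bsub>A\<^esub> c)"
      by auto
    then have "t \<odot>\<^bsub>N\<^esub> y = act N x (a \<otimes>\<^bsub>A\<^esub> (t \<odot>\<^bsub>A\<^esub> c))" "t \<odot>\<^bsub>A\<^esub> c \<in> carrier A"
      using x a act_smult_right mult_closed mult_smult_right vs.smult_closed by auto
    then show "t \<odot>\<^bsub>N\<^esub> y \<in> ?K"
      by blast
  qed
next
  fix y b assume "y \<in> ?K" and b: "b \<in> carrier A"
  then obtain c where "c \<in> carrier A" "y = act N x (a \<otimes>\<^bsub>A\<^esub> c)"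
    by auto
  then have "act N y b = act N x (a \<otimes>\<^bsub>A\<^esub> (c \<otimes>\<^bsub>A\<^esub> b))" "c \<otimes>\<^bsub>A\<^esub> b \<in> carrier A"
    using act_mult[OF x mult_closed[OF a] b] mult_assoc[OF a _ b] mult_closed[OF _ b] by simp_all
  then show "act N y b \<in> ?K"
    by blast
qed

theorem essential_imp_functionally_thick:
  assumes M: "mod_submodule A N M" and ess: "essential A N M"
  shows "functionally_thick A N M"
  unfolding functionally_thick_def
proof (intro allI impI ballI, rule ccontr)
  fix f x
  assume "mod_functional A N f \<and> (\<forall>m\<in>M. f m = \<zero>\<^bsub>A\<^esub>)"
  then have f: "mod_functional A N f" and fM: "\<And>m. m \<in> M \<Longrightarrow> f m = \<zero>\<^bsub>A\<^esub>"
    by auto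
  assume x: "x \<in> carrier N" and nz: "f x \<noteq> \<zero>\<^bsub>A\<^esub>"
  have fx: "f x \<in> carrier A"
    using f x by (simp add: mod_functional_def)
  define K where "K = (\<lambda>c. act N x (f x \<otimes>\<^bsub>A\<^esub> c)) ` carrier A"
  have sub: "mod_submodule A N K"
    unfolding K_def by (rule mod_submodule_multiples[OF x fx])
  have ker: "f x \<otimes>\<^bsub>A\<^esub> c = \<zero>\<^bsub>A\<^esub>" if "c \<in> carrier A" "f (act N x (f x \<otimes>\<^bsub>A\<^esub> c)) = \<zero>\<^bsub>A\<^esub>" for c
    using functional_inj_on_multiples[OF f x] that by blast
  have "M \<inter> K \<subseteq> {\<zero>\<^bsub>N\<^esub>}"
  proof
    fix m assume "m \<in> M \<inter> K"
    then obtain c where "c \<in> carrier A" "m = act N x (f x \<otimes>\<^bsub>A\<^esub> c)" "f m = \<zero>\<^bsub>A\<^esub>"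
      using fM by (auto simp: K_def)
    then show "m \<in> {\<zero>\<^bsub>N\<^esub>}"
      using ker[of c] act_zero[OF x] by simp
  qed
  then have "M \<inter> K = {\<zero>\<^bsub>N\<^esub>}"
    using mod_submoduleD[OF M] mod_submoduleD[OF sub] by blast
  moreover have "K \<noteq> {\<zero>\<^bsub>N\<^esub>}"
  proof
    assume "K = {\<zero>\<^bsub>N\<^esub>}"
    then have "act N x (f x \<otimes>\<^bsub>A\<^esub> star A (f x)) = \<zero>\<^bsub>N\<^esub>"
      using star_closed[OF fx] unfolding K_def by blast
    then have "f x \<otimes>\<^bsub>A\<^esub> star A (f x) = \<zero>\<^bsub>A\<^esub>"
      using ker[OF star_closed[OF fx]] functional_zero[OF f] by simp
    then have "star A (f x) = \<zero>\<^bsub>A\<^esub>"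
      using star_mult_eq_0D[OF star_closed[OF fx]] star_star[OF fx] by simp
    then show False
      using star_star[OF fx] star_zero nz by simp
  qed
  ultimately show False
    using ess sub by (auto simp: essential_def)
qed

lemma ip_add_left:
  assumes "x \<in> carrier N" "y \<in> carrier N" "z \<in> carrier N"
  shows "ip N (x \<oplus>\<^bsub>N\<^esub> y) z = ip N x z \<oplus>\<^bsub>A\<^esub> ip N y z"
  using assms ip_star ip_add_right star_add ip_closed
  by (metis mvs.add.m_closed)

lemma ip_smult_left:
  assumes "x \<in> carrier N" "z \<in> carrier N"
  shows "ip N (t \<odot>\<^bsub>N\<^esub> x) z = cnj t \<odot>\<^bsub>A\<^esub> ip N x z"
  using assms ip_star ip_smult_right star_smult ip_closed mvs.smult_closed
  by (metis UNIV_I complex_ring_simps(1))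

lemma ip_act_left:
  assumes "x \<in> carrier N" "z \<in> carrier N" "a \<in> carrier A"
  shows "ip N (act N x a) z = star A a \<otimes>\<^bsub>A\<^esub> ip N x z"
  using assms ip_star ip_act_right star_mult ip_closed act_closed
  by metis

lemma ip_zero_right: "x \<in> carrier N \<Longrightarrow> ip N x \<zero>\<^bsub>N\<^esub> = \<zero>\<^bsub>A\<^esub>"
  by (metis mvs.zero_closed ip_smult_right ip_closed mod_smult_0 smult_0)

text \<open>
  The source of the boundedness of \<open>n \<mapsto> \<langle>n, x\<rangle>\<close>: by polarization \<open>\<langle>n, x\<rangle>\<close> is a
  combination of the elements \<open>\<langle>y, y\<rangle>\<close> with \<open>y \<in> {n, x, n + x, n + \<i>x}\<close>, whose norms
  are the squares of the norms of \<open>y\<close>. So \<open>\<langle>n, x\<rangle>\<close> is bounded on the unit ball, and homogeneity does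
  the rest.
\<close>

lemma cnorm_ip_le_polarization:
  assumes n: "n \<in> carrier N" and x: "x \<in> carrier N"
  shows "cnorm A (ip N n x) \<le> 2 * (mod_norm A N n + mod_norm A N x)\<^sup>2"
proof -
  let ?p = "ip N n x" and ?q = "ip N x n" and ?nn = "ip N n n" and ?xx = "ip N x x"
  let ?s = "mod_norm A N n + mod_norm A N x"
  note cl = ip_closed[OF n x] ip_closed[OF x n] ip_closed[OF n n] ip_closed[OF x x] n x
    ip_closed mvs.smult_closed vs.smult_closed vs.add.m_closed mvs.add.m_closed
  note nn = mod_norm_nonneg[OF n] mod_norm_nonneg[OF x]
  define h where "h u = ip N (n \<oplus>\<^bsub>N\<^esub> u \<odot>\<^bsub>N\<^esub> x) (n \<oplus>\<^bsub>N\<^esub> u \<odot>\<^bsub>N\<^esub> x)" for u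
  have h_closed: "h u \<in> carrier A" for u
    unfolding h_def by (intro cl; simp add: cl)
  have h_norm: "cnorm A (h u) \<le> ?s\<^sup>2" if "cmod u = 1" for u
  proof -
    have "mod_norm A N (n \<oplus>\<^bsub>N\<^esub> u \<odot>\<^bsub>N\<^esub> x) \<le> ?s"
      using mod_norm_add[of n "u \<odot>\<^bsub>N\<^esub> x"] mod_norm_smult[of x u] that cl by simp
    moreover have "mod_norm A N (n \<oplus>\<^bsub>N\<^esub> u \<odot>\<^bsub>N\<^esub> x) \<ge> 0"
      by (intro mod_norm_nonneg) (simp add: cl)
    ultimately show ?thesis
      unfolding h_def using cl by (subst cnorm_ip_self) (auto intro: power_mono)
  qed
  have h: "h u = (?nn \<oplus>\<^bsub>A\<^esub> u \<odot>\<^bsub>A\<^esub> ?p) \<oplus>\<^bsub>A\<^esub> (cnj u \<odot>\<^bsub>A\<^esub> ?q \<oplus>\<^bsub>A\<^esub> (u * cnj u) \<odot>\<^bsub>A\<^esub> ?xx)" for u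
  proof -
    have "u \<odot>\<^bsub>A\<^esub> (cnj u \<odot>\<^bsub>A\<^esub> ?xx) = (u * cnj u) \<odot>\<^bsub>A\<^esub> ?xx"
      using vs.smult_assoc1[of u "cnj u" ?xx] cl by simp
    then show ?thesis
      unfolding h_def
      by (simp add: ip_add_left ip_add_right ip_smult_left ip_smult_right cl vs.smult_r_distr vs.add.m_ac)
  qed
  \<comment> \<open>\<open>h 1 - \<i> h \<i>\<close> contains \<open>?p\<close> twice and no \<open>?q\<close>; the last summand removes \<open>?nn\<close> and \<open>?xx\<close>\<close>
  have "(2::complex) \<odot>\<^bsub>A\<^esub> ?p = (h 1 \<oplus>\<^bsub>A\<^esub> (- \<i>) \<odot>\<^bsub>A\<^esub> h \<i>) \<oplus>\<^bsub>A\<^esub> (\<i> - 1) \<odot>\<^bsub>A\<^esub> (?nn \<oplus>\<^bsub>A\<^esub> ?xx)"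
  proof -
    have a: "s \<odot>\<^bsub>A\<^esub> (t \<odot>\<^bsub>A\<^esub> y) = (s * t) \<odot>\<^bsub>A\<^esub> y" "s \<odot>\<^bsub>A\<^esub> y \<oplus>\<^bsub>A\<^esub> t \<odot>\<^bsub>A\<^esub> y = (s + t) \<odot>\<^bsub>A\<^esub> y"
      "s \<odot>\<^bsub>A\<^esub> y \<oplus>\<^bsub>A\<^esub> (t \<odot>\<^bsub>A\<^esub> y \<oplus>\<^bsub>A\<^esub> z) = (s + t) \<odot>\<^bsub>A\<^esub> y \<oplus>\<^bsub>A\<^esub> z"
      if "y \<in> carrier A" "z \<in> carrier A" for s t y z
      using vs.smult_assoc1[of s t y] vs.smult_l_distr[of s t y] vs.add.m_assoc[of "s \<odot>\<^bsub>A\<^esub> y" "t \<odot>\<^bsub>A\<^esub> y" z] that cl 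
      by simp_all
    have one: "?p = 1 \<odot>\<^bsub>A\<^esub> ?p" "?q = 1 \<odot>\<^bsub>A\<^esub> ?q" "?nn = 1 \<odot>\<^bsub>A\<^esub> ?nn" "?xx = 1 \<odot>\<^bsub>A\<^esub> ?xx"
      using vs.smult_one cl by simp_all
    \<comment> \<open>all terms are combinations of \<open>?p\<close>, \<open>?q\<close>, \<open>?nn\<close>, \<open>?xx\<close>, which reduces the identity to one of coefficients\<close>
    let ?C = "\<lambda>a b c d. (a \<odot>\<^bsub>A\<^esub> ?p \<oplus>\<^bsub>A\<^esub> b \<odot>\<^bsub>A\<^esub> ?q) \<oplus>\<^bsub>A\<^esub> (c \<odot>\<^bsub>A\<^esub> ?nn \<oplus>\<^bsub>A\<^esub> d \<odot>\<^bsub>A\<^esub> ?xx)"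
    have C_add: "?C a b c d \<oplus>\<^bsub>A\<^esub> ?C a' b' c' d' = ?C (a + a') (b + b') (c + c') (d + d')" for a b c d a' b' c' d'
    proof -
      have "?C a b c d \<oplus>\<^bsub>A\<^esub> ?C a' b' c' d' =
        ((a \<odot>\<^bsub>A\<^esub> ?p \<oplus>\<^bsub>A\<^esub> a' \<odot>\<^bsub>A\<^esub> ?p) \<oplus>\<^bsub>A\<^esub> (b \<odot>\<^bsub>A\<^esub> ?q \<oplus>\<^bsub>A\<^esub> b' \<odot>\<^bsub>A\<^esub> ?q)) \<oplus>\<^bsub>A\<^esub> ((c \<odot>\<^bsub>A\<^esub> ?nn \<oplus>\<^bsub>A\<^esub> c' \<odot>\<^bsub>A\<^esub> ?nn) \<oplus>\<^bsub>A\<^esub> (d \<odot>\<^bsub>A\<^esub> ?xx \<oplus>\<^bsub>A\<^esub> d' \<odot>\<^bsub>A\<^esub> ?xx))"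
        by (simp add: cl vs.add.m_ac)
      then show ?thesis
        by (simp add: a(2)[OF _ vs.zero_closed] cl)
    qed
    have C_smult: "t \<odot>\<^bsub>A\<^esub> ?C a b c d = ?C (t * a) (t * b) (t * c) (t * d)" for t a b c d
      by (simp add: cl vs.smult_r_distr a(1)[OF _ vs.zero_closed])
    have hC: "h u = ?C u (cnj u) 1 (u * cnj u)" for u
      unfolding h by (subst (1) one(3)) (simp add: cl vs.add.m_ac)
    have "?nn \<oplus>\<^bsub>A\<^esub> ?xx = ?C 0 0 1 1"
      using cl one by (simp add: smult_0)
    moreover have "2 \<odot>\<^bsub>A\<^esub> ?p = ?C 2 0 0 0"
      using cl by (simp add: smult_0)
    ultimately show ?thesis
      by (simp add: hC C_smult C_add)
  qed
  then have "2 * cnorm A ?p = cnorm A ((h 1 \<oplus>\<^bsub>A\<^esub> (- \<i>) \<odot>\<^bsub>A\<^esub> h \<i>) \<oplus>\<^bsub>A\<^esub> (\<i> - 1) \<odot>\<^bsub>A\<^esub> (?nn \<oplus>\<^bsub>A\<^esub> ?xx))"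
    using norm_smult[of ?p 2] cl by simp
  also have "\<dots> \<le> cnorm A (h 1 \<oplus>\<^bsub>A\<^esub> (- \<i>) \<odot>\<^bsub>A\<^esub> h \<i>) + cnorm A ((\<i> - 1) \<odot>\<^bsub>A\<^esub> (?nn \<oplus>\<^bsub>A\<^esub> ?xx))"
    by (intro norm_add) (simp_all add: cl h_closed)
  also have "cnorm A (h 1 \<oplus>\<^bsub>A\<^esub> (- \<i>) \<odot>\<^bsub>A\<^esub> h \<i>) \<le> cnorm A (h 1) + cnorm A ((- \<i>) \<odot>\<^bsub>A\<^esub> h \<i>)"
    by (intro norm_add) (simp_all add: cl h_closed)
  also have "cnorm A ((- \<i>) \<odot>\<^bsub>A\<^esub> h \<i>) = cnorm A (h \<i>)"
    by (simp add: norm_smult h_closed)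
  also have "cnorm A ((\<i> - 1) \<odot>\<^bsub>A\<^esub> (?nn \<oplus>\<^bsub>A\<^esub> ?xx)) = cmod (\<i> - 1) * cnorm A (?nn \<oplus>\<^bsub>A\<^esub> ?xx)"
    by (simp add: norm_smult cl)
  also have "\<dots> \<le> 2 * ?s\<^sup>2"
  proof (intro mult_mono)
    show "cmod (\<i> - 1) \<le> 2"
      using norm_triangle_ineq4[of \<i> 1] by simp
    have "cnorm A (?nn \<oplus>\<^bsub>A\<^esub> ?xx) \<le> cnorm A ?nn + cnorm A ?xx"
      by (intro norm_add) (simp_all add: cl)
    also have "\<dots> \<le> ?s\<^sup>2"
      using nn by (simp add: cnorm_ip_self n x power2_sum)
    finally show "cnorm A (?nn \<oplus>\<^bsub>A\<^esub> ?xx) \<le> ?s\<^sup>2" .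
  qed (simp_all add: norm_nonneg cl)
  finally show ?thesis
    using h_norm[of 1] h_norm[of \<i>] by simp
qed

lemma ip_bounded:
  assumes x: "x \<in> carrier N"
  shows "\<exists>C. \<forall>n\<in>carrier N. cnorm A (ip N n x) \<le> C * mod_norm A N n"
proof (intro exI ballI)
  fix n assume n: "n \<in> carrier N"
  let ?r = "mod_norm A N n"
  show "cnorm A (ip N n x) \<le> 2 * (1 + mod_norm A N x)\<^sup>2 * ?r"
  proof (cases "?r = 0")
    case True
    then have "ip N n x = \<zero>\<^bsub>A\<^esub>"
      using n x mod_norm_eq_0[OF n] ip_star[of x n] ip_zero_right star_zero by auto
    then show ?thesis
      using True norm_eq_0[OF vs.zero_closed] by simp
  next
    case False
    then have r: "?r > 0"
      using mod_norm_nonneg[OF n] by simp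
    let ?c = "complex_of_real (1 / ?r)"
    have c: "cmod ?c = 1 / ?r"
      using r by (simp only: norm_of_real) simp
    have m: "?c \<odot>\<^bsub>N\<^esub> n \<in> carrier N"
      using n mvs.smult_closed by simp
    have "mod_norm A N (?c \<odot>\<^bsub>N\<^esub> n) = 1"
      using mod_norm_smult[OF n, of ?c] r c by simp
    moreover have "cnorm A (ip N (?c \<odot>\<^bsub>N\<^esub> n) x) = cnorm A (ip N n x) / ?r"
      using c by (simp only: ip_smult_left n x norm_smult ip_closed complex_mod_cnj) simp
    ultimately have "cnorm A (ip N n x) / ?r \<le> 2 * (1 + mod_norm A N x)\<^sup>2"
      using cnorm_ip_le_polarization[OF m x] by simp
    then show ?thesis
      using r by (simp add: divide_le_eq)
  qed
qed

lemma mod_functional_ip: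
  assumes x: "x \<in> carrier N"
  shows "mod_functional A N (\<lambda>n. ip N n x)"
  using ip_bounded[OF x] x
  by (simp add: mod_functional_def ip_closed ip_add_left ip_smult_left ip_act_left)

theorem functionally_thick_imp_thick:
  assumes M: "mod_submodule A N M" and thick: "functionally_thick A N M"
  shows "thick A N M"
  unfolding thick_def
proof (intro equalityI subsetI)
  fix x assume "x \<in> ortho_compl A N M"
  then have x: "x \<in> carrier N" and "\<And>m. m \<in> M \<Longrightarrow> ip N x m = \<zero>\<^bsub>A\<^esub>"
    by (auto simp: ortho_compl_def)
  then have "ip N m x = \<zero>\<^bsub>A\<^esub>" if "m \<in> M" for m
    using ip_star[of x m] that star_zero mod_submoduleD(1)[OF M] by (metis subsetD)
  then have "ip N x x = \<zero>\<^bsub>A\<^esub>"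
    using thick mod_functional_ip[OF x] x by (auto simp: functionally_thick_def)
  then show "x \<in> {\<zero>\<^bsub>N\<^esub>}"
    using ip_definite x by simp
next
  fix x assume "x \<in> {\<zero>\<^bsub>N\<^esub>}"
  then have "x = \<zero>\<^bsub>N\<^esub>"
    by simp
  moreover have "ip N \<zero>\<^bsub>N\<^esub> m = \<zero>\<^bsub>A\<^esub>" if "m \<in> M" for m
    using ip_star[of m "\<zero>\<^bsub>N\<^esub>"] ip_zero_right star_zero that mod_submoduleD[OF M] by (metis subsetD)
  ultimately show "x \<in> ortho_compl A N M"
    using mvs.zero_closed by (simp add: ortho_compl_def)
qed

end

section \<open>Banach spaces of functions on a carrier\<close>

text \<open>
  The locale \<^locale>\<open>Metric_space\<close> wants a distance that is symmetric and nonnegative on the whole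
  type, while \<open>x \<ominus> y\<close> is an unspecified value if \<open>y\<close> has no inverse in the carrier. Addition is
  therefore totalized by reading every argument outside the carrier as zero; then \<open>\<ominus> y\<close> always
  exists and \<open>nm (x \<ominus> y)\<close> is a pseudometric on the type.
\<close>

definition extend_zero :: "'v::zero set \<Rightarrow> 'v \<Rightarrow> 'v" where
  "extend_zero C x = (if x \<in> C then x else 0)"

locale function_space =
  fixes V :: "(complex, 'v::ab_group_add, 'm) module_scheme" (structure)
  assumes zero_eq: "\<zero> = 0"
    and add_eq: "x \<oplus> y = extend_zero (carrier V) x + extend_zero (carrier V) y"
    and zero_mem: "0 \<in> carrier V"
    and add_mem: "\<lbrakk>x \<in> carrier V; y \<in> carrier V\<rbrakk> \<Longrightarrow> x + y \<in> carrier V"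
    and smult_mem: "x \<in> carrier V \<Longrightarrow> t \<odot> x \<in> carrier V"
    and smult_add_left: "(s + t) \<odot> x = s \<odot> x + t \<odot> x"
    and smult_add_right: "t \<odot> (x + y) = t \<odot> x + t \<odot> y"
    and smult_smult: "s \<odot> (t \<odot> x) = (s * t) \<odot> x"
    and smult_1: "1 \<odot> x = x"
begin

lemma add_carrier: "\<lbrakk>x \<in> carrier V; y \<in> carrier V\<rbrakk> \<Longrightarrow> x \<oplus> y = x + y"
  by (simp add: add_eq extend_zero_def)

lemma extend_zero_mem [simp]: "extend_zero (carrier V) x \<in> carrier V"
  by (simp add: extend_zero_def zero_mem)

lemma smult_minus_1: "(- 1) \<odot> x = - x"
proof -
  have "0 \<odot> x = 0"
    using smult_add_left[of 0 0 x] by simp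
  then show ?thesis
    using smult_add_left[of "-1" 1 x] smult_1 by (simp add: eq_neg_iff_add_eq_0)
qed

lemma uminus_mem: "x \<in> carrier V \<Longrightarrow> - x \<in> carrier V"
  using smult_mem[of x "-1"] smult_minus_1 by simp

lemma minus_mem: "\<lbrakk>x \<in> carrier V; y \<in> carrier V\<rbrakk> \<Longrightarrow> x - y \<in> carrier V"
  using add_mem[of x "- y"] uminus_mem by simp

lemma vector_space: "complex_vector_space V"
proof (rule moduleI)
  show "cring complex_ring"
  proof (rule cringI)
    show "abelian_group complex_ring"
    proof (rule abelian_groupI)
      fix x :: complex
      show "\<exists>y\<in>carrier complex_ring. y \<oplus>\<^bsub>complex_ring\<^esub> x = \<zero>\<^bsub>complex_ring\<^esub>"
        by (rule bexI[of _ "- x"]) auto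
    qed auto
    show "comm_monoid complex_ring"
      by (rule comm_monoidI) auto
  qed (auto simp: algebra_simps)
  show "abelian_group V"
  proof (rule abelian_groupI)
    fix x assume "x \<in> carrier V"
    then show "\<exists>y\<in>carrier V. y \<oplus> x = \<zero>"
      by (intro bexI[of _ "- x"]) (auto simp: add_carrier uminus_mem zero_eq)
  qed (auto simp: add_carrier add_mem zero_mem zero_eq algebra_simps)
qed (auto simp: add_carrier add_mem smult_mem smult_add_left smult_add_right smult_smult smult_1)

lemma minus_eq: "x \<ominus> y = extend_zero (carrier V) x - extend_zero (carrier V) y"
proof -
  let ?y = "extend_zero (carrier V) y"
  have "\<ominus> y = - ?y"
    unfolding a_inv_def m_inv_def
  proof (rule the_equality)
    show "- ?y \<in> carrier (add_monoid V) \<and> y \<otimes>\<^bsub>add_monoid V\<^esub> - ?y = \<one>\<^bsub>add_monoid V\<^esub> \<and>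
      - ?y \<otimes>\<^bsub>add_monoid V\<^esub> y = \<one>\<^bsub>add_monoid V\<^esub>"
      using uminus_mem[OF extend_zero_mem[of y]] by (simp add: add_eq zero_eq extend_zero_def[of _ "- ?y"])
  next
    fix z
    assume "z \<in> carrier (add_monoid V) \<and> y \<otimes>\<^bsub>add_monoid V\<^esub> z = \<one>\<^bsub>add_monoid V\<^esub> \<and>
      z \<otimes>\<^bsub>add_monoid V\<^esub> y = \<one>\<^bsub>add_monoid V\<^esub>"
    then show "z = - ?y"
      by (auto simp: add_eq zero_eq extend_zero_def[of _ z] eq_neg_iff_add_eq_0)
  qed
  then show ?thesis
    using uminus_mem[OF extend_zero_mem[of y]]
    by (simp add: a_minus_def add_eq extend_zero_def[of _ "- ?y"])
qed

end

locale normed_function_space = function_space V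
  for V :: "(complex, 'v::ab_group_add, 'm) module_scheme" (structure) +
  fixes nm :: "'v \<Rightarrow> real"
  assumes nm_nonneg: "x \<in> carrier V \<Longrightarrow> nm x \<ge> 0"
    and nm_eq_0: "x \<in> carrier V \<Longrightarrow> nm x = 0 \<longleftrightarrow> x = 0"
    and nm_smult: "x \<in> carrier V \<Longrightarrow> nm (t \<odot> x) = cmod t * nm x"
    and nm_add: "\<lbrakk>x \<in> carrier V; y \<in> carrier V\<rbrakk> \<Longrightarrow> nm (x + y) \<le> nm x + nm y"
begin

lemma metric: "Metric_space (carrier V) (\<lambda>x y. nm (x \<ominus> y))"
proof
  fix x y z
  show "0 \<le> nm (x \<ominus> y)"
    by (simp add: minus_eq nm_nonneg minus_mem)
  show "nm (x \<ominus> y) = nm (y \<ominus> x)"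
    using nm_smult[of "extend_zero (carrier V) x - extend_zero (carrier V) y" "-1"]
    by (simp add: minus_eq minus_mem smult_minus_1)
  assume xy: "x \<in> carrier V" "y \<in> carrier V"
  then show "nm (x \<ominus> y) = 0 \<longleftrightarrow> x = y"
    by (simp add: minus_eq extend_zero_def nm_eq_0 minus_mem)
  assume "z \<in> carrier V"
  then show "nm (x \<ominus> z) \<le> nm (x \<ominus> y) + nm (y \<ominus> z)"
    using xy nm_add[of "x - y" "y - z"] by (simp add: minus_eq extend_zero_def minus_mem)
qed

sublocale metric: Metric_space "carrier V" "\<lambda>x y. nm (x \<ominus> y)"
  by (rule metric)

lemma limitin_iff:
  assumes "range \<sigma> \<subseteq> carrier V"
  shows "limitin metric.mtopology \<sigma> l sequentially \<longleftrightarrow>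
    l \<in> carrier V \<and> (\<lambda>i. nm (\<sigma> i - l)) \<longlonglongrightarrow> 0"
proof -
  have "nm (\<sigma> i \<ominus> l) = nm (\<sigma> i - l)" if "l \<in> carrier V" for i
    using assms that by (auto simp: minus_eq extend_zero_def)
  moreover have "\<forall>\<^sub>F i in sequentially. \<sigma> i \<in> carrier V"
    using assms by (auto intro: always_eventually)
  ultimately show ?thesis
    unfolding metric.limitin_metric_dist_null by (auto cong: conj_cong)
qed

lemma banach_normI:
  assumes "\<And>\<sigma>. \<lbrakk>range \<sigma> \<subseteq> carrier V; \<And>\<epsilon>. \<epsilon> > 0 \<Longrightarrow> \<exists>I. \<forall>i\<ge>I. \<forall>j\<ge>I. nm (\<sigma> i - \<sigma> j) < \<epsilon>\<rbrakk>
    \<Longrightarrow> \<exists>l\<in>carrier V. (\<lambda>i. nm (\<sigma> i - l)) \<longlonglongrightarrow> 0"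
  shows "banach_norm V nm"
proof -
  have "metric.mcomplete"
    unfolding metric.mcomplete_def
  proof (intro allI impI)
    fix \<sigma> assume "metric.MCauchy \<sigma>"
    then have \<sigma>: "range \<sigma> \<subseteq> carrier V"
      and "\<And>\<epsilon>. \<epsilon> > 0 \<Longrightarrow> \<exists>I. \<forall>i j. I \<le> i \<longrightarrow> I \<le> j \<longrightarrow> nm (\<sigma> i \<ominus> \<sigma> j) < \<epsilon>"
      unfolding metric.MCauchy_def by blast+
    moreover have "nm (\<sigma> i \<ominus> \<sigma> j) = nm (\<sigma> i - \<sigma> j)" for i j
      using \<sigma> by (auto simp: minus_eq extend_zero_def)
    ultimately show "\<exists>l. limitin metric.mtopology \<sigma> l sequentially"
      using assms[of \<sigma>] unfolding limitin_iff[OF \<sigma>] by metis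
  qed
  then show ?thesis
    by (simp add: banach_norm_def nm_nonneg nm_eq_0 nm_smult zero_eq add_carrier nm_add)
qed

end

section \<open>The algebra of bounded continuous functions\<close>

definition Cb :: "(real \<Rightarrow> complex) set" where
  "Cb = {a. continuous_on UNIV a \<and> bounded (range a)}"

lemma Cb_const [simp]: "(\<lambda>s. c) \<in> Cb"
  by (simp add: Cb_def)

lemma Cb_zero [simp]: "0 \<in> Cb"
  by (simp add: zero_fun_def)

lemma Cb_bounded:
  assumes "a \<in> Cb"
  shows "\<exists>B\<ge>0. \<forall>s. cmod (a s) \<le> B"
proof -
  obtain B where "\<And>s. cmod (a s) \<le> B"
    using assms by (auto simp: Cb_def bounded_iff)
  moreover from this[of 0] have "0 \<le> B"
    using norm_ge_zero order_trans by blast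
  ultimately show ?thesis
    by blast
qed

lemma CbI: "\<lbrakk>continuous_on UNIV a; \<And>s. cmod (a s) \<le> B\<rbrakk> \<Longrightarrow> a \<in> Cb"
  by (auto simp: Cb_def bounded_iff)

lemma Cb_continuous: "a \<in> Cb \<Longrightarrow> continuous_on UNIV a"
  by (simp add: Cb_def)

lemma Cb_add: "(\<lambda>s. a s + b s) \<in> Cb" if ab: "a \<in> Cb" "b \<in> Cb"
proof -
  obtain B D where "\<And>s. cmod (a s) \<le> B" "\<And>s. cmod (b s) \<le> D"
    using Cb_bounded[OF ab(1)] Cb_bounded[OF ab(2)] by blast
  then have "cmod (a s + b s) \<le> B + D" for s
    by (intro norm_triangle_le add_mono)
  then show ?thesis
    using ab by (intro CbI[OF continuous_on_add]) (auto simp: Cb_continuous)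
qed

lemma Cb_mult: "(\<lambda>s. a s * b s) \<in> Cb" if ab: "a \<in> Cb" "b \<in> Cb"
proof -
  obtain B D where "B \<ge> 0" "\<And>s. cmod (a s) \<le> B" "\<And>s. cmod (b s) \<le> D"
    using Cb_bounded[OF ab(1)] Cb_bounded[OF ab(2)] by blast
  then have "cmod (a s * b s) \<le> B * D" for s
    by (simp add: norm_mult mult_mono)
  then show ?thesis
    using ab by (intro CbI[OF continuous_on_mult]) (auto simp: Cb_continuous)
qed

lemma Cb_cnj: "(\<lambda>s. cnj (a s)) \<in> Cb" if a: "a \<in> Cb"
proof -
  obtain B where "\<And>s. cmod (a s) \<le> B"
    using Cb_bounded[OF a] by blast
  then show ?thesis
    using a by (intro CbI[OF continuous_on_cnj]) (auto simp: Cb_continuous)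
qed

lemma Cb_sum: "(\<And>k. k \<in> K \<Longrightarrow> a k \<in> Cb) \<Longrightarrow> (\<lambda>s. \<Sum>k\<in>K. a k s) \<in> Cb"
  by (induction K rule: infinite_finite_induct) (auto intro: Cb_add)

lemma Cb_uniform_closure:
  assumes approx: "\<And>\<epsilon>. \<epsilon> > 0 \<Longrightarrow> \<exists>b\<in>Cb. \<forall>s. cmod (b s - a s) \<le> \<epsilon>"
  shows "a \<in> Cb"
proof -
  have "\<exists>b\<in>Cb. \<forall>s. cmod (b s - a s) \<le> inverse (real (Suc n))" for n
    by (rule approx) simp
  then obtain b where b: "\<And>n. b n \<in> Cb" "\<And>n s. cmod (b n s - a s) \<le> inverse (real (Suc n))"
    by metis
  have "uniform_limit UNIV b a sequentially"
  proof (rule uniform_limitI)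
    fix e :: real assume "e > 0"
    then have "\<forall>\<^sub>F n in sequentially. inverse (real (Suc n)) < e"
      using LIMSEQ_inverse_real_of_nat by (rule order_tendstoD(2)[rotated])
    then show "\<forall>\<^sub>F n in sequentially. \<forall>x\<in>UNIV. dist (b n x) (a x) < e"
      by eventually_elim (metis b(2) dist_norm le_less_trans)
  qed
  then have "continuous_on UNIV a"
    by (rule uniform_limit_theorem[rotated]) (use b(1) in \<open>auto simp: Cb_continuous\<close>)
  moreover obtain B where "\<And>s. cmod (b 0 s) \<le> B"
    using Cb_bounded[OF b(1)] by blast
  then have "cmod (a s) \<le> B + 1" for s
    using b(2)[of 0 s] norm_triangle_ineq4[of "b 0 s" "b 0 s - a s"] by (smt (verit) diff_diff_eq2 add_diff_cancel_left' inverse_1 of_nat_1 One_nat_def)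
  ultimately show ?thesis
    by (rule CbI)
qed

definition Cb_algebra :: "(real \<Rightarrow> complex) cstar_alg" where
  "Cb_algebra = \<lparr>carrier = Cb, mult = (*), one = 1, zero = 0,
     add = (\<lambda>a b. extend_zero Cb a + extend_zero Cb b), smult = (\<lambda>t a s. t * a s),
     star = (\<lambda>a s. cnj (a s)), cnorm = (\<lambda>a. SUP s. cmod (a s))\<rparr>"

lemma Cb_algebra_simps [simp]:
  "carrier Cb_algebra = Cb" "mult Cb_algebra = (*)" "zero Cb_algebra = 0"
  "smult Cb_algebra = (\<lambda>t a s. t * a s)" "star Cb_algebra = (\<lambda>a s. cnj (a s))"
  "cnorm Cb_algebra = (\<lambda>a. SUP s. cmod (a s))"
  "\<lbrakk>a \<in> Cb; b \<in> Cb\<rbrakk> \<Longrightarrow> a \<oplus>\<^bsub>Cb_algebra\<^esub> b = a + b"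
  by (simp_all add: Cb_algebra_def extend_zero_def)

lemma sup_norm_le_iff: "(SUP s. cmod (a s)) \<le> C \<longleftrightarrow> (\<forall>s. cmod (a s) \<le> C)" if a: "a \<in> Cb"
proof -
  obtain B where "\<And>s. cmod (a s) \<le> B"
    using Cb_bounded[OF a] by blast
  then have "bdd_above (range (\<lambda>s. cmod (a s)))"
    by (intro bdd_aboveI[of _ B]) auto
  then show ?thesis
    by (subst cSUP_le_iff) auto
qed

lemma le_sup_norm: "a \<in> Cb \<Longrightarrow> cmod (a s) \<le> (SUP s. cmod (a s))"
  using sup_norm_le_iff[of a "SUP s. cmod (a s)"] by simp

lemma sup_norm_nonneg: "a \<in> Cb \<Longrightarrow> 0 \<le> (SUP s. cmod (a s))"
  using le_sup_norm[of a 0] norm_ge_zero order_trans by blast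

lemma Cb_closed [intro, simp]:
  "\<lbrakk>a \<in> Cb; b \<in> Cb\<rbrakk> \<Longrightarrow> a + b \<in> Cb"
  "\<lbrakk>a \<in> Cb; b \<in> Cb\<rbrakk> \<Longrightarrow> a * b \<in> Cb"
  "a \<in> Cb \<Longrightarrow> (\<lambda>s. c * a s) \<in> Cb"
  "a \<in> Cb \<Longrightarrow> (\<lambda>s. cnj (a s)) \<in> Cb"
  by (simp_all add: plus_fun_def times_fun_def Cb_add Cb_mult Cb_cnj)

lemma Cb_normed_function_space: "normed_function_space Cb_algebra (cnorm Cb_algebra)"
proof
  fix a b :: "real \<Rightarrow> complex" and s t :: complex
  show "a \<oplus>\<^bsub>Cb_algebra\<^esub> b = extend_zero (carrier Cb_algebra) a + extend_zero (carrier Cb_algebra) b"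
    by (simp add: Cb_algebra_def)
  assume "a \<in> carrier Cb_algebra"
  then have a: "a \<in> Cb"
    by simp
  show "0 \<le> cnorm Cb_algebra a"
    using a by (simp add: sup_norm_nonneg)
  show "(cnorm Cb_algebra a = 0) = (a = 0)"
  proof
    assume "cnorm Cb_algebra a = 0"
    then show "a = 0"
      using sup_norm_le_iff[OF a, of 0] by (auto simp: fun_eq_iff)
  qed simp
  show "cnorm Cb_algebra (t \<odot>\<^bsub>Cb_algebra\<^esub> a) = cmod t * cnorm Cb_algebra a"
  proof (rule antisym)
    show "cnorm Cb_algebra (t \<odot>\<^bsub>Cb_algebra\<^esub> a) \<le> cmod t * cnorm Cb_algebra a"
      using a sup_norm_le_iff[of "\<lambda>s. t * a s"]
      by (simp add: norm_mult le_sup_norm mult_left_mono)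
    show "cmod t * cnorm Cb_algebra a \<le> cnorm Cb_algebra (t \<odot>\<^bsub>Cb_algebra\<^esub> a)"
    proof (cases "t = 0")
      case False
      have "cmod (a s) \<le> cnorm Cb_algebra (t \<odot>\<^bsub>Cb_algebra\<^esub> a) / cmod t" for s
        using le_sup_norm[of "\<lambda>s. t * a s" s] a False by (simp add: norm_mult field_simps)
      then have "cnorm Cb_algebra a \<le> cnorm Cb_algebra (t \<odot>\<^bsub>Cb_algebra\<^esub> a) / cmod t"
        using sup_norm_le_iff[OF a] by simp
      then show ?thesis
        using False by (simp add: field_simps)
    qed simp
  qed
  assume "b \<in> carrier Cb_algebra"
  then have b: "b \<in> Cb"
    by simp
  show "cnorm Cb_algebra (a + b) \<le> cnorm Cb_algebra a + cnorm Cb_algebra b"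
    using sup_norm_le_iff[OF Cb_closed(1)[OF a b]] le_sup_norm[OF a] le_sup_norm[OF b]
    by (simp add: norm_triangle_le add_mono)
qed (auto simp: fun_eq_iff algebra_simps)

text \<open>
  Completeness is that of uniform convergence: a Cauchy sequence for the supremum norm converges
  uniformly, and uniform limits of bounded continuous functions are of the same kind.
\<close>

lemma Cb_cstar_algebra: "cstar_algebra Cb_algebra"
proof -
  interpret normed_function_space Cb_algebra "cnorm Cb_algebra"
    by (rule Cb_normed_function_space)
  show ?thesis
  proof (rule cstar_algebra.intro)
    show "complex_vector_space Cb_algebra"
      by (rule vector_space)
    show "banach_norm Cb_algebra (cnorm Cb_algebra)"
    proof (rule banach_normI)
      fix \<sigma> :: "nat \<Rightarrow> real \<Rightarrow> complex"
      assume "range \<sigma> \<subseteq> carrier Cb_algebra"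
        and cauchy: "\<And>\<epsilon>. 0 < \<epsilon> \<Longrightarrow> \<exists>I. \<forall>i\<ge>I. \<forall>j\<ge>I. cnorm Cb_algebra (\<sigma> i - \<sigma> j) < \<epsilon>"
      then have \<sigma>: "\<sigma> i \<in> Cb" for i
        by auto
      have diff: "\<sigma> i - \<sigma> j \<in> Cb" for i j
        using minus_mem \<sigma> by simp
      have "uniformly_Cauchy_on UNIV \<sigma>"
        unfolding uniformly_Cauchy_on_def
        using cauchy le_sup_norm[OF diff] by (simp add: dist_norm) (meson le_less_trans)
      then obtain l where l: "uniform_limit UNIV \<sigma> l sequentially"
        using uniformly_convergent_eq_Cauchy uniformly_convergent_on_def by blast
      have ev: "\<forall>\<^sub>F i in sequentially. \<forall>s. cmod (\<sigma> i s - l s) \<le> \<epsilon>" if "\<epsilon> > 0" for \<epsilon>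
        using uniform_limitD[OF l that] by (auto simp: dist_norm elim!: eventually_mono intro: less_imp_le)
      have "l \<in> Cb"
      proof (rule Cb_uniform_closure)
        fix \<epsilon> :: real assume "\<epsilon> > 0"
        then obtain i where "\<forall>s. cmod (\<sigma> i s - l s) \<le> \<epsilon>"
          using eventually_happens[OF ev] by auto
        then show "\<exists>b\<in>Cb. \<forall>s. cmod (b s - l s) \<le> \<epsilon>"
          using \<sigma> by blast
      qed
      moreover have "(\<lambda>i. cnorm Cb_algebra (\<sigma> i - l)) \<longlonglongrightarrow> 0"
      proof (rule tendstoI)
        fix e :: real assume "e > 0"
        have diff: "\<sigma> i - l \<in> Cb" for i
          using minus_mem \<sigma> \<open>l \<in> Cb\<close> by simp
        have "dist (cnorm Cb_algebra (\<sigma> i - l)) 0 < e" if "\<forall>s. cmod (\<sigma> i s - l s) \<le> e / 2" for i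
        proof -
          have "cnorm Cb_algebra (\<sigma> i - l) \<le> e / 2" "cnorm Cb_algebra (\<sigma> i - l) \<ge> 0"
            using that sup_norm_le_iff[OF diff, of i "e / 2"] sup_norm_nonneg[OF diff, of i]
            by (simp_all only: Cb_algebra_simps fun_diff_def simp_thms)
          then show ?thesis
            using \<open>e > 0\<close> by (simp only: dist_real_def)
        qed
        then show "\<forall>\<^sub>F i in sequentially. dist (cnorm Cb_algebra (\<sigma> i - l)) 0 < e"
          using ev[of "e / 2"] \<open>e > 0\<close> by (auto elim!: eventually_mono simp del: Cb_algebra_simps)
      qed
      ultimately show "\<exists>l\<in>carrier Cb_algebra. (\<lambda>i. cnorm Cb_algebra (\<sigma> i - l)) \<longlonglongrightarrow> 0"
        by auto
    qed
  next
    fix a b assume "a \<in> carrier Cb_algebra" "b \<in> carrier Cb_algebra"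
    then have ab: "a \<in> Cb" "b \<in> Cb"
      by simp_all
    show "cnorm Cb_algebra (a \<otimes>\<^bsub>Cb_algebra\<^esub> b) \<le> cnorm Cb_algebra a * cnorm Cb_algebra b"
      using sup_norm_le_iff[OF Cb_closed(2)[OF ab]] ab
      by (simp add: norm_mult mult_mono le_sup_norm sup_norm_nonneg)
  next
    fix a assume "a \<in> carrier Cb_algebra"
    then have a: "a \<in> Cb" and aa: "(\<lambda>s. cnj (a s)) * a \<in> Cb"
      by simp_all
    show "cnorm Cb_algebra (star Cb_algebra a \<otimes>\<^bsub>Cb_algebra\<^esub> a) = (cnorm Cb_algebra a)\<^sup>2"
    proof (rule antisym)
      show "cnorm Cb_algebra (star Cb_algebra a \<otimes>\<^bsub>Cb_algebra\<^esub> a) \<le> (cnorm Cb_algebra a)\<^sup>2"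
        using a aa sup_norm_le_iff[OF aa]
        by (simp add: norm_mult power2_eq_square mult_mono le_sup_norm sup_norm_nonneg)
      have "cmod (a s) \<le> sqrt (cnorm Cb_algebra (star Cb_algebra a \<otimes>\<^bsub>Cb_algebra\<^esub> a))" for s
        using le_sup_norm[OF aa, of s] by (intro real_le_rsqrt) (simp add: norm_mult power2_eq_square)
      then have "cnorm Cb_algebra a \<le> sqrt (cnorm Cb_algebra (star Cb_algebra a \<otimes>\<^bsub>Cb_algebra\<^esub> a))"
        using sup_norm_le_iff[OF a] by simp
      then show "(cnorm Cb_algebra a)\<^sup>2 \<le> cnorm Cb_algebra (star Cb_algebra a \<otimes>\<^bsub>Cb_algebra\<^esub> a)"
        using sqrt_ge_absD sup_norm_nonneg[OF a] by simp
    qed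
  qed (auto simp: fun_eq_iff algebra_simps)
qed

section \<open>The standard Hilbert module\<close>

text \<open>
  Square summability is expressed by bounds on finite partial sums. Sequences \<open>v\<close> with such a bound,
  but without uniformly small tails, still pair with the standard module and give functionals that
  need not be inner products with one of its elements. The bound is written as a square \<open>C\<^sup>2\<close>
  wherever \<open>C\<close> plays the role of a norm.
\<close>

definition l2_bounded :: "(nat \<Rightarrow> real \<Rightarrow> complex) \<Rightarrow> real \<Rightarrow> bool" where
  "l2_bounded x B \<longleftrightarrow> (\<forall>m s. (\<Sum>k<m. (cmod (x k s))\<^sup>2) \<le> B)"

definition l2_sections :: "(nat \<Rightarrow> real \<Rightarrow> complex) set" where
  "l2_sections = {x. (\<forall>k. x k \<in> Cb) \<and>
     (\<forall>\<epsilon>>0. \<exists>n. \<forall>m s. (\<Sum>k=n..<m. (cmod (x k s))\<^sup>2) \<le> \<epsilon>)}"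

definition pairing :: "(nat \<Rightarrow> real \<Rightarrow> complex) \<Rightarrow> (nat \<Rightarrow> real \<Rightarrow> complex) \<Rightarrow> real \<Rightarrow> complex" where
  "pairing v x s = (\<Sum>k. cnj (v k s) * x k s)"

definition tail :: "nat \<Rightarrow> (nat \<Rightarrow> real \<Rightarrow> complex) \<Rightarrow> nat \<Rightarrow> real \<Rightarrow> complex" where
  "tail n x k s = (if k < n then 0 else x k s)"

definition coord :: "nat \<Rightarrow> (real \<Rightarrow> complex) \<Rightarrow> nat \<Rightarrow> real \<Rightarrow> complex" where
  "coord j a k s = (if k = j then a s else 0)"

lemma sum_tail: "(\<Sum>k<m. (cmod (tail n x k s))\<^sup>2) = (\<Sum>k=n..<m. (cmod (x k s))\<^sup>2)"
  by (rule sum.mono_neutral_cong_right) (auto simp: tail_def)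

lemma l2_boundedD: "l2_bounded x B \<Longrightarrow> (\<Sum>k<m. (cmod (x k s))\<^sup>2) \<le> B"
  by (simp add: l2_bounded_def)

lemma l2_bounded_nonneg: "l2_bounded x B \<Longrightarrow> 0 \<le> B"
  using l2_boundedD[of x B 0 0] by simp

lemma l2_bounded_coordinate: "l2_bounded x (C\<^sup>2) \<Longrightarrow> 0 \<le> C \<Longrightarrow> cmod (x k s) \<le> C"
proof -
  assume x: "l2_bounded x (C\<^sup>2)" and C: "0 \<le> C"
  have "(cmod (x k s))\<^sup>2 \<le> (\<Sum>j<Suc k. (cmod (x j s))\<^sup>2)"
    by (rule member_le_sum) auto
  also have "\<dots> \<le> C\<^sup>2"
    using x by (rule l2_boundedD)
  finally show ?thesis
    using C by (simp add: abs_le_square_iff[symmetric])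
qed

lemma l2_summable: "l2_bounded x B \<Longrightarrow> summable (\<lambda>k. (cmod (x k s))\<^sup>2)"
  by (rule summableI_nonneg_bounded[of _ B]) (auto simp: l2_boundedD)

lemma l2_bounded_add:
  assumes x: "l2_bounded x (C\<^sup>2)" "0 \<le> C" and y: "l2_bounded y (D\<^sup>2)" "0 \<le> D"
  shows "l2_bounded (x + y) ((C + D)\<^sup>2)"
  unfolding l2_bounded_def
proof (intro allI)
  fix m s
  have "L2_set (\<lambda>k. cmod ((x + y) k s)) {..<m} \<le> L2_set (\<lambda>k. cmod (x k s) + cmod (y k s)) {..<m}"
    by (rule L2_set_mono) (auto simp: norm_triangle_ineq)
  also have "\<dots> \<le> L2_set (\<lambda>k. cmod (x k s)) {..<m} + L2_set (\<lambda>k. cmod (y k s)) {..<m}"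
    by (rule L2_set_triangle_ineq)
  also have "\<dots> \<le> C + D"
    using real_sqrt_le_mono[OF l2_boundedD[OF x(1), of s m]] real_sqrt_le_mono[OF l2_boundedD[OF y(1), of s m]] x y
    by (simp add: L2_set_def)
  finally show "(\<Sum>k<m. (cmod ((x + y) k s))\<^sup>2) \<le> (C + D)\<^sup>2"
    using x y unfolding L2_set_def by (simp add: real_sqrt_le_iff sqrt_le_D)
qed

lemma l2_bounded_scale:
  assumes x: "l2_bounded x B" and a: "\<And>s. cmod (a s) \<le> D"
  shows "l2_bounded (\<lambda>k s. a s * x k s) (D\<^sup>2 * B)"
  unfolding l2_bounded_def
proof (intro allI)
  fix m s
  have "(\<Sum>k<m. (cmod (a s * x k s))\<^sup>2) = (cmod (a s))\<^sup>2 * (\<Sum>k<m. (cmod (x k s))\<^sup>2)"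
    by (simp add: norm_mult power_mult_distrib sum_distrib_left)
  also have "\<dots> \<le> D\<^sup>2 * B"
    using a[of s] l2_boundedD[OF x] l2_bounded_nonneg[OF x]
    by (intro mult_mono power_mono) (auto intro: sum_nonneg)
  finally show "(\<Sum>k<m. (cmod (a s * x k s))\<^sup>2) \<le> D\<^sup>2 * B" .
qed

lemma l2_sections_iff:
  "x \<in> l2_sections \<longleftrightarrow> (\<forall>k. x k \<in> Cb) \<and> (\<forall>\<epsilon>>0. \<exists>n. l2_bounded (tail n x) (\<epsilon>\<^sup>2))"
proof -
  have "(\<forall>\<epsilon>>0. \<exists>n. l2_bounded (tail n x) (\<epsilon>\<^sup>2)) \<longleftrightarrow> (\<forall>\<epsilon>>0. \<exists>n. l2_bounded (tail n x) \<epsilon>)"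
    (is "?l = ?r")
  proof
    assume l: ?l
    show ?r
    proof (intro allI impI)
      fix \<epsilon> :: real assume "\<epsilon> > 0"
      then show "\<exists>n. l2_bounded (tail n x) \<epsilon>"
        using l[rule_format, of "sqrt \<epsilon>"] by simp
    qed
  qed simp
  then show ?thesis
    by (simp add: l2_sections_def l2_bounded_def sum_tail)
qed

lemma l2_sections_coordinate: "x \<in> l2_sections \<Longrightarrow> x k \<in> Cb"
  by (simp add: l2_sections_iff)

lemma l2_sections_tail: "\<lbrakk>x \<in> l2_sections; \<epsilon> > 0\<rbrakk> \<Longrightarrow> \<exists>n. l2_bounded (tail n x) (\<epsilon>\<^sup>2)"
  by (simp add: l2_sections_iff)

lemma tail_0: "tail 0 x = x"
  by (simp add: tail_def fun_eq_iff)

lemma tail_tail: "n \<le> n' \<Longrightarrow> tail n' (tail n x) = tail n' x"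
  by (auto simp: tail_def fun_eq_iff)

lemma l2_bounded_tail_mono: "l2_bounded (tail n x) B \<Longrightarrow> n \<le> n' \<Longrightarrow> l2_bounded (tail n' x) B"
  unfolding l2_bounded_def sum_tail
  by (meson order_trans sum_mono2 finite_atLeastLessThan ivl_subset order_refl zero_le_power2)

lemma l2_sections_bounded: "x \<in> l2_sections \<Longrightarrow> \<exists>C\<ge>0. l2_bounded x (C\<^sup>2)"
proof -
  assume x: "x \<in> l2_sections"
  obtain n where n: "l2_bounded (tail n x) (1\<^sup>2)"
    using l2_sections_tail[OF x, of 1] by auto
  have "\<forall>k. \<exists>B. \<forall>s. cmod (x k s) \<le> B"
    using Cb_bounded l2_sections_coordinate[OF x] by blast
  then obtain B where B: "\<And>k s. cmod (x k s) \<le> B k"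
    by metis
  have "l2_bounded x ((\<Sum>k<n. (B k)\<^sup>2) + 1)"
    unfolding l2_bounded_def
  proof (intro allI)
    fix m s
    have "(\<Sum>k<m. (cmod (x k s))\<^sup>2) \<le> (\<Sum>k\<in>{..<n} \<union> {n..<m}. (cmod (x k s))\<^sup>2)"
      by (rule sum_mono2) auto
    also have "\<dots> = (\<Sum>k<n. (cmod (x k s))\<^sup>2) + (\<Sum>k=n..<m. (cmod (x k s))\<^sup>2)"
      by (rule sum.union_disjoint) auto
    also have "\<dots> \<le> (\<Sum>k<n. (B k)\<^sup>2) + 1"
      using l2_boundedD[OF n, of s m] B by (intro add_mono sum_mono power_mono) (auto simp: sum_tail)
    finally show "(\<Sum>k<m. (cmod (x k s))\<^sup>2) \<le> (\<Sum>k<n. (B k)\<^sup>2) + 1" .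
  qed
  then show ?thesis
    using l2_bounded_nonneg by (intro exI[of _ "sqrt ((\<Sum>k<n. (B k)\<^sup>2) + 1)"]) (auto intro: add_nonneg_nonneg sum_nonneg)
qed

lemma l2_sections_add: "x + y \<in> l2_sections" if xy: "x \<in> l2_sections" "y \<in> l2_sections"
proof -
  have "\<exists>n. l2_bounded (tail n (x + y)) (\<epsilon>\<^sup>2)" if "\<epsilon> > 0" for \<epsilon>
  proof -
    obtain n where "l2_bounded (tail n x) ((\<epsilon> / 2)\<^sup>2)"
      using l2_sections_tail[OF xy(1), of "\<epsilon> / 2"] \<open>\<epsilon> > 0\<close> by auto
    moreover obtain n' where "l2_bounded (tail n' y) ((\<epsilon> / 2)\<^sup>2)"
      using l2_sections_tail[OF xy(2), of "\<epsilon> / 2"] \<open>\<epsilon> > 0\<close> by auto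
    ultimately have "l2_bounded (tail (max n n') x) ((\<epsilon> / 2)\<^sup>2)" "l2_bounded (tail (max n n') y) ((\<epsilon> / 2)\<^sup>2)"
      by (auto elim!: l2_bounded_tail_mono)
    from l2_bounded_add[OF this(1) _ this(2)]
    have "l2_bounded (tail (max n n') x + tail (max n n') y) (\<epsilon>\<^sup>2)"
      using that by simp
    moreover have "tail (max n n') x + tail (max n n') y = tail (max n n') (x + y)"
      by (auto simp: tail_def fun_eq_iff)
    ultimately show ?thesis
      by auto
  qed
  then show ?thesis
    using xy by (auto simp: l2_sections_iff)
qed

lemma l2_sections_scale: "(\<lambda>k s. a s * x k s) \<in> l2_sections" if x: "x \<in> l2_sections" and a: "a \<in> Cb"
proof -
  obtain D where D: "D \<ge> 0" "\<And>s. cmod (a s) \<le> D"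
    using Cb_bounded[OF a] by blast
  have "\<exists>n. l2_bounded (tail n (\<lambda>k s. a s * x k s)) (\<epsilon>\<^sup>2)" if "\<epsilon> > 0" for \<epsilon>
  proof -
    obtain n where n: "l2_bounded (tail n x) ((\<epsilon> / (D + 1))\<^sup>2)"
      using l2_sections_tail[OF x, of "\<epsilon> / (D + 1)"] D \<open>\<epsilon> > 0\<close> by auto
    have "(D + 1)\<^sup>2 * (\<epsilon> / (D + 1))\<^sup>2 = \<epsilon>\<^sup>2"
      using D by (simp add: power_divide)
    moreover have "cmod (a s) \<le> D + 1" for s
      using D(2)[of s] by simp
    ultimately have "l2_bounded (\<lambda>k s. a s * tail n x k s) (\<epsilon>\<^sup>2)"
      using l2_bounded_scale[OF n] by metis
    moreover have "(\<lambda>k s. a s * tail n x k s) = tail n (\<lambda>k s. a s * x k s)"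
      by (auto simp: tail_def fun_eq_iff)
    ultimately show ?thesis
      by auto
  qed
  then show ?thesis
    using x a by (auto simp: l2_sections_iff Cb_mult)
qed

lemma l2_sections_zero: "0 \<in> l2_sections"
  by (simp add: l2_sections_iff l2_bounded_def sum_tail)

lemma coord_mem: "coord j a \<in> l2_sections" if "a \<in> Cb"
proof -
  have "coord j a k \<in> Cb" for k
    using that by (cases "k = j") (auto simp: coord_def[abs_def])
  moreover have "tail (Suc j) (coord j a) = 0"
    by (auto simp: tail_def coord_def fun_eq_iff)
  then have "l2_bounded (tail (Suc j) (coord j a)) (\<epsilon>\<^sup>2)" for \<epsilon>
    by (simp add: l2_bounded_def)
  ultimately show ?thesis
    by (auto simp: l2_sections_iff)
qed

lemma pairing_summable:
  assumes "l2_bounded v B" "l2_bounded x D"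
  shows "summable (\<lambda>k. cnj (v k s) * x k s)"
proof (rule summable_comparison_test')
  show "summable (\<lambda>k. (cmod (v k s))\<^sup>2 + (cmod (x k s))\<^sup>2)"
    using assms by (intro summable_add l2_summable)
  show "cmod (cnj (v k s) * x k s) \<le> (cmod (v k s))\<^sup>2 + (cmod (x k s))\<^sup>2" if "k \<ge> 0" for k
    using sum_squares_bound[of "cmod (v k s)" "cmod (x k s)"]
      mult_nonneg_nonneg[OF norm_ge_zero norm_ge_zero, of "v k s" "x k s"]
    unfolding norm_mult complex_mod_cnj by linarith
qed

lemma pairing_sums:
  assumes "l2_bounded v B" "l2_bounded x D"
  shows "(\<lambda>k. cnj (v k s) * x k s) sums pairing v x s"
  unfolding pairing_def using pairing_summable[OF assms] by (rule summable_sums)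

lemma norm_pairing_le:
  assumes v: "l2_bounded v (C\<^sup>2)" "0 \<le> C" and x: "l2_bounded x (D\<^sup>2)" "0 \<le> D"
  shows "cmod (pairing v x s) \<le> C * D"
proof (rule tendsto_upperbound)
  show "(\<lambda>m. cmod (\<Sum>k<m. cnj (v k s) * x k s)) \<longlonglongrightarrow> cmod (pairing v x s)"
    using pairing_sums[OF v(1) x(1)] by (auto simp: sums_def intro: tendsto_norm)
  have "cmod (\<Sum>k<m. cnj (v k s) * x k s) \<le> C * D" for m
  proof -
    have "cmod (\<Sum>k<m. cnj (v k s) * x k s) \<le> (\<Sum>k<m. \<bar>cmod (v k s)\<bar> * \<bar>cmod (x k s)\<bar>)"
      by (rule order_trans[OF norm_sum]) (simp add: norm_mult)
    also have "\<dots> \<le> L2_set (\<lambda>k. cmod (v k s)) {..<m} * L2_set (\<lambda>k. cmod (x k s)) {..<m}"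
      by (rule L2_set_mult_ineq)
    also have "\<dots> \<le> C * D"
      using real_sqrt_le_mono[OF l2_boundedD[OF v(1), of s m]] real_sqrt_le_mono[OF l2_boundedD[OF x(1), of s m]] v x
      by (intro mult_mono) (auto simp: L2_set_def intro: sum_nonneg)
    finally show ?thesis .
  qed
  then show "\<forall>\<^sub>F m in sequentially. cmod (\<Sum>k<m. cnj (v k s) * x k s) \<le> C * D"
    by simp
qed simp

lemma pairing_tail:
  assumes "l2_bounded v B" "l2_bounded x D"
  shows "pairing v x s = (\<Sum>k<n. cnj (v k s) * x k s) + pairing v (tail n x) s"
proof -
  have "(\<lambda>k. cnj (v k s) * tail n x k s) sums (pairing v x s - (\<Sum>k<n. cnj (v k s) * x k s))"
  proof -
    have "(\<lambda>k. cnj (v k s) * x k s - (if k \<in> {..<n} then cnj (v k s) * x k s else 0)) sums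
      (pairing v x s - (\<Sum>k<n. cnj (v k s) * x k s))"
      using assms by (intro sums_diff pairing_sums sums_If_finite_set) auto
    moreover have "(\<lambda>k. cnj (v k s) * x k s - (if k \<in> {..<n} then cnj (v k s) * x k s else 0)) =
      (\<lambda>k. cnj (v k s) * tail n x k s)"
      by (auto simp: tail_def)
    ultimately show ?thesis
      by simp
  qed
  then have "pairing v (tail n x) s = pairing v x s - (\<Sum>k<n. cnj (v k s) * x k s)"
    unfolding pairing_def[of v "tail n x"] by (rule sums_unique[symmetric])
  then show ?thesis
    by simp
qed

text \<open>
  It suffices that the second argument has uniformly small tails: the error of the finite partial sums
  is the pairing with a tail, which the Cauchy-Schwarz inequality controls uniformly. With both
  arguments in the module this is the inner product; with \<open>v\<close> merely bounded it is the
  conjugate of a functional.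
\<close>

lemma pairing_mem_Cb:
  assumes v: "\<And>k. v k \<in> Cb" "l2_bounded v (C\<^sup>2)" "0 \<le> C" and x: "x \<in> l2_sections"
  shows "pairing v x \<in> Cb"
proof (rule Cb_uniform_closure)
  fix \<epsilon> :: real assume \<epsilon>: "\<epsilon> > 0"
  obtain D where D: "l2_bounded x (D\<^sup>2)"
    using l2_sections_bounded[OF x] by blast
  obtain n where n: "l2_bounded (tail n x) ((\<epsilon> / (C + 1))\<^sup>2)"
    using l2_sections_tail[OF x, of "\<epsilon> / (C + 1)"] \<epsilon> v(3) by auto
  have "cmod ((\<Sum>k<n. cnj (v k s) * x k s) - pairing v x s) \<le> \<epsilon>" for s
  proof -
    have "cmod ((\<Sum>k<n. cnj (v k s) * x k s) - pairing v x s) = cmod (pairing v (tail n x) s)"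
      using pairing_tail[OF v(2) D, of s n] by simp
    also have "\<dots> \<le> C * (\<epsilon> / (C + 1))"
      using v \<epsilon> by (intro norm_pairing_le n) auto
    also have "\<dots> \<le> \<epsilon>"
      using v(3) \<epsilon> by (simp add: field_simps)
    finally show ?thesis .
  qed
  moreover have "(\<lambda>s. \<Sum>k<n. cnj (v k s) * x k s) \<in> Cb"
    using v(1) x by (intro Cb_sum Cb_mult Cb_cnj) (auto simp: l2_sections_coordinate)
  ultimately show "\<exists>b\<in>Cb. \<forall>s. cmod (b s - pairing v x s) \<le> \<epsilon>"
    by (intro bexI[of _ "\<lambda>s. \<Sum>k<n. cnj (v k s) * x k s"]) auto
qed

definition l2_module :: "(real \<Rightarrow> complex, nat \<Rightarrow> real \<Rightarrow> complex) hilbert_mod" where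
  "l2_module = \<lparr>carrier = l2_sections, mult = (\<lambda>x y. 0), one = 0, zero = 0,
     add = (\<lambda>x y. extend_zero l2_sections x + extend_zero l2_sections y),
     smult = (\<lambda>t x k s. t * x k s), act = (\<lambda>x a k s. a s * x k s), ip = pairing\<rparr>"

lemma l2_module_simps [simp]:
  "carrier l2_module = l2_sections" "zero l2_module = 0"
  "smult l2_module = (\<lambda>t x k s. t * x k s)" "act l2_module = (\<lambda>x a k s. a s * x k s)"
  "ip l2_module = pairing"
  "\<lbrakk>x \<in> l2_sections; y \<in> l2_sections\<rbrakk> \<Longrightarrow> x \<oplus>\<^bsub>l2_module\<^esub> y = x + y"
  by (simp_all add: l2_module_def extend_zero_def)

abbreviation l2_norm :: "(nat \<Rightarrow> real \<Rightarrow> complex) \<Rightarrow> real" where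
  "l2_norm \<equiv> mod_norm Cb_algebra l2_module"

lemma pairing_sections_mem: "\<lbrakk>x \<in> l2_sections; y \<in> l2_sections\<rbrakk> \<Longrightarrow> pairing x y \<in> Cb"
  using l2_sections_bounded[of x] by (auto intro: pairing_mem_Cb l2_sections_coordinate)

lemma pairing_self: "pairing x x s = of_real (\<Sum>k. (cmod (x k s))\<^sup>2)" if "l2_bounded x B"
proof -
  have "cnj z * z = of_real ((cmod z)\<^sup>2)" for z
    by (metis complex_norm_square mult.commute of_real_power)
  then show ?thesis
    unfolding pairing_def using l2_summable[OF that, of s] by (simp add: suminf_of_real)
qed

text \<open>
  This is the bridge through which all metric questions about the module become questions about finite
  sums of numbers, uniform in the point.
\<close>

lemma l2_norm_le_iff:
  assumes x: "x \<in> l2_sections" and C: "0 \<le> C"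
  shows "l2_norm x \<le> C \<longleftrightarrow> l2_bounded x (C\<^sup>2)"
proof -
  obtain B where B: "l2_bounded x B"
    using l2_sections_bounded[OF x] by blast
  have pos: "0 \<le> (\<Sum>k. (cmod (x k s))\<^sup>2)" for s
    by (rule suminf_nonneg[OF l2_summable[OF B]]) simp
  have "l2_norm x \<le> C \<longleftrightarrow> cnorm Cb_algebra (pairing x x) \<le> C\<^sup>2"
    using C real_sqrt_le_iff[of "cnorm Cb_algebra (pairing x x)" "C\<^sup>2"]
    by (simp add: mod_norm_def del: Cb_algebra_simps real_sqrt_le_iff)
  also have "\<dots> \<longleftrightarrow> (\<forall>s. cmod (pairing x x s) \<le> C\<^sup>2)"
    using sup_norm_le_iff[OF pairing_sections_mem[OF x x]] by simp
  also have "\<dots> \<longleftrightarrow> (\<forall>s. (\<Sum>k. (cmod (x k s))\<^sup>2) \<le> C\<^sup>2)"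
    using pos by (simp add: pairing_self[OF B])
  also have "\<dots> \<longleftrightarrow> l2_bounded x (C\<^sup>2)"
  proof
    assume "\<forall>s. (\<Sum>k. (cmod (x k s))\<^sup>2) \<le> C\<^sup>2"
    moreover have "(\<Sum>k<m. (cmod (x k s))\<^sup>2) \<le> (\<Sum>k. (cmod (x k s))\<^sup>2)" for m s
      by (rule sum_le_suminf[OF l2_summable[OF B]]) auto
    ultimately show "l2_bounded x (C\<^sup>2)"
      unfolding l2_bounded_def using order_trans by blast
  next
    assume "l2_bounded x (C\<^sup>2)"
    then show "\<forall>s. (\<Sum>k. (cmod (x k s))\<^sup>2) \<le> C\<^sup>2"
      by (intro allI suminf_le_const[OF l2_summable[OF B]]) (rule l2_boundedD)
  qed
  finally show ?thesis .
qed

lemma l2_norm_nonneg: "x \<in> l2_sections \<Longrightarrow> 0 \<le> l2_norm x"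
  unfolding mod_norm_def using sup_norm_nonneg[OF pairing_sections_mem] by simp

lemma l2_norm_bound: "x \<in> l2_sections \<Longrightarrow> l2_bounded x ((l2_norm x)\<^sup>2)"
  using l2_norm_le_iff[of x "l2_norm x"] l2_norm_nonneg by simp

lemma coordinate_le_l2_norm: "x \<in> l2_sections \<Longrightarrow> cmod (x k s) \<le> l2_norm x"
  using l2_bounded_coordinate l2_norm_bound l2_norm_nonneg by blast

lemma l2_sections_smult: "x \<in> l2_sections \<Longrightarrow> (\<lambda>k s. t * x k s) \<in> l2_sections"
  using l2_sections_scale[of x "\<lambda>s. t"] by simp

lemma pairing_add_right:
  "pairing v (x + y) s = pairing v x s + pairing v y s"
  if "l2_bounded v B" "l2_bounded x C" "l2_bounded y D"
  using sums_add[OF pairing_sums[OF that(1,2), of s] pairing_sums[OF that(1,3), of s]]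
  unfolding pairing_def[of v "x + y"] by (intro sums_unique[symmetric]) (simp add: algebra_simps)

lemma pairing_scale_right:
  "pairing v (\<lambda>k s. a s * x k s) s = a s * pairing v x s" if "l2_bounded v B" "l2_bounded x C"
  using sums_mult[OF pairing_sums[OF that, of s], of "a s"]
  unfolding pairing_def[of v "\<lambda>k s. a s * x k s"] by (intro sums_unique[symmetric]) (simp add: algebra_simps)

lemma pairing_cnj:
  "cnj (pairing x y s) = pairing y x s" if "l2_bounded x B" "l2_bounded y D"
proof -
  have "(\<lambda>k. cnj (cnj (x k s) * y k s)) sums cnj (pairing x y s)"
    using pairing_sums[OF that] by (simp only: sums_cnj)
  then have "(\<lambda>k. cnj (y k s) * x k s) sums cnj (pairing x y s)"
    by (simp add: mult.commute)
  then show ?thesis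
    unfolding pairing_def[of y x] by (rule sums_unique)
qed

lemma l2_normed_function_space: "normed_function_space l2_module l2_norm"
proof
  fix x y :: "nat \<Rightarrow> real \<Rightarrow> complex" and t :: complex
  show "x \<oplus>\<^bsub>l2_module\<^esub> y = extend_zero (carrier l2_module) x + extend_zero (carrier l2_module) y"
    by (simp add: l2_module_def)
  show "0 \<in> carrier l2_module"
    by (simp add: l2_sections_zero)
  assume "x \<in> carrier l2_module"
  then have x: "x \<in> l2_sections"
    by simp
  then show "t \<odot>\<^bsub>l2_module\<^esub> x \<in> carrier l2_module"
    by (simp add: l2_sections_smult)
  show "0 \<le> l2_norm x"
    using x by (rule l2_norm_nonneg)
  show "l2_norm x = 0 \<longleftrightarrow> x = 0"
  proof
    assume "l2_norm x = 0"
    then show "x = 0"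
      using coordinate_le_l2_norm[OF x] by (auto simp: fun_eq_iff)
  next
    assume "x = 0"
    then show "l2_norm x = 0"
      by (simp add: mod_norm_def pairing_def)
  qed
  have le: "l2_norm (\<lambda>k s. t * x k s) \<le> cmod t * l2_norm x" if "x \<in> l2_sections" for t x
  proof -
    have "l2_bounded (\<lambda>k s. t * x k s) ((cmod t)\<^sup>2 * (l2_norm x)\<^sup>2)"
      using l2_bounded_scale[OF l2_norm_bound[OF that], of "\<lambda>s. t"] by simp
    then show ?thesis
      using that by (subst l2_norm_le_iff) (auto simp: l2_sections_smult l2_norm_nonneg power_mult_distrib)
  qed
  show "l2_norm (t \<odot>\<^bsub>l2_module\<^esub> x) = cmod t * l2_norm x"
  proof (cases "t = 0")
    case True
    then show ?thesis
      using le[OF x, of 0] l2_norm_nonneg[OF l2_sections_smult[OF x, of 0]] by simp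
  next
    case False
    then have "l2_norm x \<le> cmod (inverse t) * l2_norm (\<lambda>k s. t * x k s)"
      using le[OF l2_sections_smult[OF x, of t], of "inverse t"] by (simp add: mult.assoc[symmetric])
    then show ?thesis
      using le[OF x, of t] False by (simp add: norm_inverse norm_divide field_simps)
  qed
  assume "y \<in> carrier l2_module"
  then have y: "y \<in> l2_sections"
    by simp
  show "x + y \<in> carrier l2_module"
    using l2_sections_add x y by simp
  show "l2_norm (x + y) \<le> l2_norm x + l2_norm y"
    using l2_bounded_add[OF l2_norm_bound[OF x] _ l2_norm_bound[OF y]] x y
    by (subst l2_norm_le_iff) (auto simp: l2_norm_nonneg l2_sections_add)
qed (auto simp: fun_eq_iff algebra_simps)

interpretation l2: normed_function_space l2_module l2_norm
  by (rule l2_normed_function_space)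

lemma l2_minus_mem: "\<lbrakk>x \<in> l2_sections; y \<in> l2_sections\<rbrakk> \<Longrightarrow> x - y \<in> l2_sections"
  using l2.minus_mem by simp

text \<open>
  A Cauchy sequence converges at every coordinate and point. The Cauchy estimate on finite partial sums
  passes to the limit, which shows convergence in norm, continuity of the limit coordinates and, by
  comparison with one term of the sequence, smallness of the tails of the limit.
\<close>

lemma l2_banach: "banach_norm l2_module l2_norm"
proof (rule l2.banach_normI)
  fix \<sigma> :: "nat \<Rightarrow> nat \<Rightarrow> real \<Rightarrow> complex"
  assume "range \<sigma> \<subseteq> carrier l2_module"
    and cauchy: "\<And>\<epsilon>. 0 < \<epsilon> \<Longrightarrow> \<exists>I. \<forall>i\<ge>I. \<forall>j\<ge>I. l2_norm (\<sigma> i - \<sigma> j) < \<epsilon>"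
  then have \<sigma>: "\<sigma> i \<in> l2_sections" for i
    by auto
  have "Cauchy (\<lambda>i. \<sigma> i k s)" for k s
  proof (rule CauchyI)
    fix e :: real assume "e > 0"
    then obtain I where "\<And>i j. \<lbrakk>i \<ge> I; j \<ge> I\<rbrakk> \<Longrightarrow> l2_norm (\<sigma> i - \<sigma> j) < e"
      using cauchy by blast
    moreover have "cmod (\<sigma> i k s - \<sigma> j k s) \<le> l2_norm (\<sigma> i - \<sigma> j)" for i j
      using coordinate_le_l2_norm[OF l2_minus_mem[OF \<sigma> \<sigma>], of i j k s] by simp
    ultimately show "\<exists>I. \<forall>i\<ge>I. \<forall>j\<ge>I. cmod (\<sigma> i k s - \<sigma> j k s) < e"
      by (meson le_less_trans)
  qed
  then have "\<forall>k s. \<exists>l. (\<lambda>i. \<sigma> i k s) \<longlonglongrightarrow> l"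
    by (simp add: Cauchy_convergent_iff convergent_def)
  then obtain l where l: "\<And>k s. (\<lambda>i. \<sigma> i k s) \<longlonglongrightarrow> l k s"
    by metis
  have close: "\<exists>I. \<forall>i\<ge>I. l2_bounded (\<sigma> i - l) (\<epsilon>\<^sup>2)" if "\<epsilon> > 0" for \<epsilon>
  proof -
    obtain I where I: "\<And>i j. \<lbrakk>i \<ge> I; j \<ge> I\<rbrakk> \<Longrightarrow> l2_norm (\<sigma> i - \<sigma> j) < \<epsilon>"
      using cauchy[OF \<open>\<epsilon> > 0\<close>] by blast
    have "(\<Sum>k<m. (cmod ((\<sigma> i - l) k s))\<^sup>2) \<le> \<epsilon>\<^sup>2" if "i \<ge> I" for i m s
    proof (rule tendsto_upperbound)
      show "(\<lambda>j. \<Sum>k<m. (cmod (\<sigma> i k s - \<sigma> j k s))\<^sup>2) \<longlonglongrightarrow> (\<Sum>k<m. (cmod ((\<sigma> i - l) k s))\<^sup>2)"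
        by (auto intro!: tendsto_intros l)
      have "(\<Sum>k<m. (cmod (\<sigma> i k s - \<sigma> j k s))\<^sup>2) \<le> \<epsilon>\<^sup>2" if "j \<ge> I" for j
      proof -
        have "l2_bounded (\<sigma> i - \<sigma> j) (\<epsilon>\<^sup>2)"
          using l2_norm_le_iff[OF l2_minus_mem[OF \<sigma> \<sigma>], of \<epsilon> i j] I[OF \<open>i \<ge> I\<close> \<open>j \<ge> I\<close>] \<open>\<epsilon> > 0\<close> by auto
        then show ?thesis
          using l2_boundedD by fastforce
      qed
      then show "\<forall>\<^sub>F j in sequentially. (\<Sum>k<m. (cmod (\<sigma> i k s - \<sigma> j k s))\<^sup>2) \<le> \<epsilon>\<^sup>2"
        by (auto simp: eventually_sequentially)
    qed simp
    then show ?thesis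
      unfolding l2_bounded_def by blast
  qed
  have l_mem: "l \<in> l2_sections"
    unfolding l2_sections_iff
  proof (intro conjI allI impI)
    fix k show "l k \<in> Cb"
    proof (rule Cb_uniform_closure)
      fix \<epsilon> :: real assume "\<epsilon> > 0"
      then obtain i where "l2_bounded (\<sigma> i - l) (\<epsilon>\<^sup>2)"
        using close by blast
      then have "\<forall>s. cmod (\<sigma> i k s - l k s) \<le> \<epsilon>"
        using l2_bounded_coordinate[of "\<sigma> i - l" \<epsilon> k] \<open>\<epsilon> > 0\<close> by auto
      then show "\<exists>b\<in>Cb. \<forall>s. cmod (b s - l k s) \<le> \<epsilon>"
        using \<sigma> l2_sections_coordinate by blast
    qed
  next
    fix \<epsilon> :: real assume "\<epsilon> > 0"
    then obtain i where i: "l2_bounded (\<sigma> i - l) ((\<epsilon> / 2)\<^sup>2)"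
      using close[of "\<epsilon> / 2"] by auto
    obtain n where n: "l2_bounded (tail n (\<sigma> i)) ((\<epsilon> / 2)\<^sup>2)"
      using l2_sections_tail[OF \<sigma>, of "\<epsilon> / 2"] \<open>\<epsilon> > 0\<close> by auto
    have "l2_bounded (l - \<sigma> i) ((\<epsilon> / 2)\<^sup>2)"
      using i by (simp add: l2_bounded_def norm_minus_commute)
    then have "l2_bounded (tail n (l - \<sigma> i)) ((\<epsilon> / 2)\<^sup>2)"
      using l2_bounded_tail_mono[of 0 "l - \<sigma> i"] by (simp add: tail_0)
    from l2_bounded_add[OF n _ this]
    have "l2_bounded (tail n (\<sigma> i) + tail n (l - \<sigma> i)) (\<epsilon>\<^sup>2)"
      using \<open>\<epsilon> > 0\<close> by simp
    moreover have "tail n (\<sigma> i) + tail n (l - \<sigma> i) = tail n l"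
      by (auto simp: tail_def fun_eq_iff)
    ultimately show "\<exists>n. l2_bounded (tail n l) (\<epsilon>\<^sup>2)"
      by auto
  qed
  have "(\<lambda>i. l2_norm (\<sigma> i - l)) \<longlonglongrightarrow> 0"
  proof (rule tendstoI)
    fix e :: real assume "e > 0"
    then obtain I where I: "\<And>i. i \<ge> I \<Longrightarrow> l2_bounded (\<sigma> i - l) ((e / 2)\<^sup>2)"
      using close[of "e / 2"] by auto
    have "dist (l2_norm (\<sigma> i - l)) 0 < e" if "i \<ge> I" for i
      using l2_norm_le_iff[OF l2_minus_mem[OF \<sigma> l_mem], of "e / 2" i] I[OF that] \<open>e > 0\<close>
        l2_norm_nonneg[OF l2_minus_mem[OF \<sigma> l_mem], of i]
      by simp
    then show "\<forall>\<^sub>F i in sequentially. dist (l2_norm (\<sigma> i - l)) 0 < e"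
      by (auto simp: eventually_sequentially)
  qed
  then show "\<exists>l\<in>carrier l2_module. (\<lambda>i. l2_norm (\<sigma> i - l)) \<longlonglongrightarrow> 0"
    using l_mem by auto
qed

lemma l2_pairing_simps:
  assumes "x \<in> l2_sections" "y \<in> l2_sections" "z \<in> l2_sections"
  shows "pairing x (y + z) = pairing x y + pairing x z"
    "pairing x (\<lambda>k s. a s * y k s) = pairing x y * a"
    "(\<lambda>s. cnj (pairing x y s)) = pairing y x"
  using pairing_add_right pairing_scale_right pairing_cnj assms[THEN l2_norm_bound]
  by (auto simp: fun_eq_iff mult.commute)

text \<open>
  The square root of a nonnegative bounded continuous function is again one.
\<close>

lemma pairing_self_positive:
  assumes x: "x \<in> l2_sections"
  shows "cstar_positive Cb_algebra (pairing x x)"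
proof -
  define b where "b s = complex_of_real (sqrt (cmod (pairing x x s)))" for s
  note mem = pairing_sections_mem[OF x x]
  obtain B where "\<And>s. cmod (pairing x x s) \<le> B"
    using Cb_bounded[OF mem] by blast
  then have "cmod (b s) \<le> sqrt B" for s
    by (simp add: b_def)
  moreover have "continuous_on UNIV b"
    unfolding b_def using Cb_continuous[OF mem]
    by (intro continuous_intros)
  ultimately have "b \<in> Cb"
    by (metis CbI)
  moreover have "pairing x x s = cnj (b s) * b s" for s
  proof -
    have "0 \<le> (\<Sum>k. (cmod (x k s))\<^sup>2)"
      by (rule suminf_nonneg[OF l2_summable[OF l2_norm_bound[OF x]]]) simp
    then have "pairing x x s = of_real (cmod (pairing x x s))"
      by (simp add: pairing_self[OF l2_norm_bound[OF x]])
    then show ?thesis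
      by (simp add: b_def flip: of_real_mult)
  qed
  ultimately show ?thesis
    by (auto simp: cstar_positive_def fun_eq_iff)
qed

theorem l2_hilbert_module: "hilbert_module Cb_algebra l2_module"
proof (intro hilbert_module.intro Cb_cstar_algebra hilbert_module_axioms.intro)
  show "complex_vector_space l2_module"
    by (rule l2.vector_space)
  show "banach_norm l2_module l2_norm"
    by (rule l2_banach)
  fix x y z :: "nat \<Rightarrow> real \<Rightarrow> complex" and a b :: "real \<Rightarrow> complex" and t :: complex
  assume "x \<in> carrier l2_module"
  then have x: "x \<in> l2_sections"
    by simp
  show "cstar_positive Cb_algebra (ip l2_module x x)"
    using x by (simp add: pairing_self_positive)
  show "x = \<zero>\<^bsub>l2_module\<^esub>" if "ip l2_module x x = \<zero>\<^bsub>Cb_algebra\<^esub>"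
  proof -
    have "l2_norm x = 0"
      using that by (simp add: mod_norm_def)
    then show ?thesis
      using l2.nm_eq_0 x by simp
  qed
  show "act l2_module x a \<in> carrier l2_module" if "a \<in> carrier Cb_algebra"
    using x that by (simp add: l2_sections_scale)
  show "act l2_module x (a \<oplus>\<^bsub>Cb_algebra\<^esub> b) = act l2_module x a \<oplus>\<^bsub>l2_module\<^esub> act l2_module x b"
    if "a \<in> carrier Cb_algebra" "b \<in> carrier Cb_algebra"
    using x that by (simp add: l2_sections_scale fun_eq_iff algebra_simps)
  assume "y \<in> carrier l2_module"
  then have y: "y \<in> l2_sections"
    by simp
  show "act l2_module (x \<oplus>\<^bsub>l2_module\<^esub> y) a = act l2_module x a \<oplus>\<^bsub>l2_module\<^esub> act l2_module y a"
    if "a \<in> carrier Cb_algebra"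
    using x y that by (simp add: l2_sections_scale fun_eq_iff algebra_simps)
  show "ip l2_module x y \<in> carrier Cb_algebra"
    using x y by (simp add: pairing_sections_mem)
  show "ip l2_module x (t \<odot>\<^bsub>l2_module\<^esub> y) = t \<odot>\<^bsub>Cb_algebra\<^esub> ip l2_module x y"
    using l2_pairing_simps(2)[OF x y y, of "\<lambda>s. t"] by (simp add: fun_eq_iff mult.commute)
  show "ip l2_module x (act l2_module y a) = ip l2_module x y \<otimes>\<^bsub>Cb_algebra\<^esub> a"
    using l2_pairing_simps(2)[OF x y y] by simp
  show "star Cb_algebra (ip l2_module x y) = ip l2_module y x"
    using l2_pairing_simps(3)[OF x y y] by simp
  assume "z \<in> carrier l2_module"
  then show "ip l2_module x (y \<oplus>\<^bsub>l2_module\<^esub> z) = ip l2_module x y \<oplus>\<^bsub>Cb_algebra\<^esub> ip l2_module x z"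
    using l2_pairing_simps(1)[OF x y] x y by (simp add: pairing_sections_mem)
qed (auto simp: fun_eq_iff algebra_simps)

section \<open>Submodules and functionals of the standard module\<close>

text \<open>
  Both counterexamples are cut out by scalar conditions, each of which lives at a single point \<open>p i\<close> of
  the line. That makes its kernel invariant under the algebra; boundedness makes it closed.
\<close>

lemma closed_submodule_kernel:
  fixes \<phi> :: "'i \<Rightarrow> (nat \<Rightarrow> real \<Rightarrow> complex) \<Rightarrow> complex"
  assumes add: "\<And>i x y. \<lbrakk>x \<in> l2_sections; y \<in> l2_sections\<rbrakk> \<Longrightarrow> \<phi> i (x + y) = \<phi> i x + \<phi> i y"
    and scale: "\<And>i x a. \<lbrakk>x \<in> l2_sections; a \<in> Cb\<rbrakk> \<Longrightarrow> \<phi> i (\<lambda>k s. a s * x k s) = a (p i) * \<phi> i x"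
    and bound: "\<And>i. \<exists>B. \<forall>x\<in>l2_sections. cmod (\<phi> i x) \<le> B * l2_norm x"
  shows "closed_submodule Cb_algebra l2_module {x \<in> l2_sections. \<forall>i. \<phi> i x = 0}" (is "closed_submodule _ _ ?M")
proof -
  have smult: "\<phi> i (\<lambda>k s. t * x k s) = t * \<phi> i x" if "x \<in> l2_sections" for i t x
    using scale[OF that, of "\<lambda>s. t"] by simp
  have "\<phi> i 0 = 0" for i
    using smult[OF l2_sections_zero, of i 0] by (simp add: zero_fun_def)
  then have "submodule ?M complex_ring l2_module"
    by (intro submodule_complexI l2.vector_space)
      (auto simp: l2_sections_zero l2_sections_add l2_sections_smult add smult)
  then have "mod_submodule Cb_algebra l2_module ?M"
    by (auto simp: mod_submodule_def l2_sections_scale scale)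
  moreover have "closedin l2.metric.mtopology ?M"
    unfolding l2.metric.metric_closedin_iff_sequentially_closed
  proof (intro conjI allI impI)
    fix \<sigma> l assume "range \<sigma> \<subseteq> ?M \<and> limitin l2.metric.mtopology \<sigma> l sequentially"
    then have \<sigma>: "\<And>j. \<sigma> j \<in> l2_sections" "\<And>i j. \<phi> i (\<sigma> j) = 0"
      and lim: "limitin l2.metric.mtopology \<sigma> l sequentially"
      by auto
    have "range \<sigma> \<subseteq> carrier l2_module"
      using \<sigma>(1) by auto
    then have l: "l \<in> l2_sections" and null: "(\<lambda>j. l2_norm (\<sigma> j - l)) \<longlonglongrightarrow> 0"
      using lim l2.limitin_iff by auto
    have "\<phi> i l = 0" for i
    proof -
      obtain B where B: "\<And>x. x \<in> l2_sections \<Longrightarrow> cmod (\<phi> i x) \<le> B * l2_norm x"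
        using bound by blast
      have "\<phi> i (\<sigma> j - l) + \<phi> i l = 0" for j
        using add[OF l2_minus_mem[OF \<sigma>(1) l] l, of i j] \<sigma>(2) by simp
      then have "cmod (\<phi> i l) = cmod (\<phi> i (\<sigma> j - l))" for j
        by (metis add_eq_0_iff norm_minus_cancel)
      then have "cmod (\<phi> i l) \<le> B * l2_norm (\<sigma> j - l)" for j
        using B[OF l2_minus_mem[OF \<sigma>(1) l]] by metis
      moreover have "(\<lambda>j. B * l2_norm (\<sigma> j - l)) \<longlonglongrightarrow> B * 0"
        using null by (rule tendsto_mult_left)
      ultimately have "cmod (\<phi> i l) \<le> 0"
        using LIMSEQ_le_const by fastforce
      then show ?thesis
        by simp
    qed
    then show "l \<in> ?M"
      using l by simp
  qed auto
  ultimately show ?thesis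
    by (simp add: closed_submodule_def mod_topology_def)
qed

lemma tail_mem: "tail n x \<in> l2_sections" if x: "x \<in> l2_sections"
proof -
  have "tail n x k \<in> Cb" for k
    using l2_sections_coordinate[OF x, of k] by (cases "k < n") (auto simp: tail_def[abs_def])
  moreover have "\<exists>m. l2_bounded (tail m (tail n x)) (\<epsilon>\<^sup>2)" if "\<epsilon> > 0" for \<epsilon>
  proof -
    obtain m where "l2_bounded (tail m x) (\<epsilon>\<^sup>2)"
      using l2_sections_tail[OF x \<open>\<epsilon> > 0\<close>] by blast
    then have "l2_bounded (tail (max m n) x) (\<epsilon>\<^sup>2)"
      by (rule l2_bounded_tail_mono) simp
    then have "l2_bounded (tail (max m n) (tail n x)) (\<epsilon>\<^sup>2)"
      by (simp add: tail_tail)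
    then show ?thesis
      by blast
  qed
  ultimately show ?thesis
    by (simp add: l2_sections_iff)
qed

lemma l2_norm_tail: "(\<lambda>n. l2_norm (tail n x)) \<longlonglongrightarrow> 0" if x: "x \<in> l2_sections"
proof (rule tendstoI)
  fix e :: real assume "e > 0"
  then obtain m where m: "l2_bounded (tail m x) ((e / 2)\<^sup>2)"
    using l2_sections_tail[OF x, of "e / 2"] by auto
  have "dist (l2_norm (tail n x)) 0 < e" if "n \<ge> m" for n
    using l2_norm_le_iff[OF tail_mem[OF x], of "e / 2" n] l2_bounded_tail_mono[OF m that] \<open>e > 0\<close>
      l2_norm_nonneg[OF tail_mem[OF x], of n]
    by simp
  then show "\<forall>\<^sub>F n in sequentially. dist (l2_norm (tail n x)) 0 < e"
    by (auto simp: eventually_sequentially)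
qed

lemma l2_functional_simps:
  assumes f: "mod_functional Cb_algebra l2_module f"
  shows "x \<in> l2_sections \<Longrightarrow> f x \<in> Cb"
    and "\<lbrakk>x \<in> l2_sections; y \<in> l2_sections\<rbrakk> \<Longrightarrow> f (x + y) s = f x s + f y s"
    and "\<lbrakk>x \<in> l2_sections; a \<in> Cb\<rbrakk> \<Longrightarrow> f (\<lambda>k s. a s * x k s) s = cnj (a s) * f x s"
    and "\<exists>C. \<forall>x\<in>l2_sections. \<forall>s. cmod (f x s) \<le> C * l2_norm x"
proof -
  have mem: "f x \<in> Cb" if "x \<in> l2_sections" for x
    using f that by (simp add: mod_functional_def)
  show "x \<in> l2_sections \<Longrightarrow> f x \<in> Cb"
    by (rule mem)
  show "f (x + y) s = f x s + f y s" if "x \<in> l2_sections" "y \<in> l2_sections"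
  proof -
    have "f (x \<oplus>\<^bsub>l2_module\<^esub> y) = f x \<oplus>\<^bsub>Cb_algebra\<^esub> f y"
      using f that unfolding mod_functional_def by simp
    then show ?thesis
      using that mem by simp
  qed
  show "f (\<lambda>k s. a s * x k s) s = cnj (a s) * f x s" if "x \<in> l2_sections" "a \<in> Cb"
  proof -
    have "f (act l2_module x a) = star Cb_algebra a \<otimes>\<^bsub>Cb_algebra\<^esub> f x"
      using f that unfolding mod_functional_def by simp
    then show ?thesis
      by simp
  qed
  obtain C where "\<forall>x\<in>l2_sections. cnorm Cb_algebra (f x) \<le> C * l2_norm x"
    using f unfolding mod_functional_def by auto
  then show "\<exists>C. \<forall>x\<in>l2_sections. \<forall>s. cmod (f x s) \<le> C * l2_norm x"
    using sup_norm_le_iff[OF mem] by (intro exI[of _ C]) simp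
qed

text \<open>
  A functional is determined by its values on the coordinate elements, since the tails of \<open>x\<close> tend to
  zero in norm and the functional is bounded.
\<close>

lemma functional_expansion:
  assumes f: "mod_functional Cb_algebra l2_module f" and x: "x \<in> l2_sections"
  shows "(\<lambda>k. cnj (x k s) * f (coord k (\<lambda>s. 1)) s) sums f x s"
proof -
  note fs = l2_functional_simps[OF f]
  obtain C where C: "\<And>x s. x \<in> l2_sections \<Longrightarrow> cmod (f x s) \<le> C * l2_norm x"
    using fs(4) by blast
  have split: "f x s = (\<Sum>k<n. cnj (x k s) * f (coord k (\<lambda>s. 1)) s) + f (tail n x) s" for n
  proof (induction n)
    case 0
    show ?case
      by (simp add: tail_0)
  next
    case (Suc n)
    have "tail n x = (\<lambda>k s. x n s * coord n (\<lambda>s. 1) k s) + tail (Suc n) x"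
      by (auto simp: tail_def coord_def fun_eq_iff)
    moreover have "(\<lambda>k s. x n s * coord n (\<lambda>s. 1) k s) \<in> l2_sections"
      using x by (intro l2_sections_scale coord_mem) (auto simp: l2_sections_coordinate)
    ultimately have "f (tail n x) s = f (\<lambda>k s. x n s * coord n (\<lambda>s. 1) k s) s + f (tail (Suc n) x) s"
      using fs(2) tail_mem[OF x] by metis
    also have "f (\<lambda>k s. x n s * coord n (\<lambda>s. 1) k s) s = cnj (x n s) * f (coord n (\<lambda>s. 1)) s"
      using x by (intro fs(3) coord_mem) (auto simp: l2_sections_coordinate)
    finally show ?case
      using Suc by simp
  qed
  have "(\<lambda>n. f (tail n x) s) \<longlonglongrightarrow> 0"
  proof (rule Lim_null_comparison)
    show "\<forall>\<^sub>F n in sequentially. cmod (f (tail n x) s) \<le> C * l2_norm (tail n x)"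
      using C tail_mem[OF x] by simp
    show "(\<lambda>n. C * l2_norm (tail n x)) \<longlonglongrightarrow> 0"
      using tendsto_mult_left[OF l2_norm_tail[OF x], of C] by simp
  qed
  then have "(\<lambda>n. f x s - f (tail n x) s) \<longlonglongrightarrow> f x s - 0"
    by (intro tendsto_diff tendsto_const)
  moreover have "f x s - f (tail n x) s = (\<Sum>k<n. cnj (x k s) * f (coord k (\<lambda>s. 1)) s)" for n
    using split[of n] by simp
  ultimately show ?thesis
    by (simp add: sums_def)
qed

lemma Cb_nonzero_locally:
  assumes a: "a \<in> Cb" and nz: "a s \<noteq> 0"
  obtains \<delta> c where "\<delta> > 0" "c > 0" "\<And>t. \<bar>t - s\<bar> < \<delta> \<Longrightarrow> c \<le> cmod (a t)"
proof -
  have "isCont a s"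
    using Cb_continuous[OF a] by (simp add: continuous_on_eq_continuous_at)
  moreover have "cmod (a s) / 2 > 0"
    using nz by simp
  ultimately obtain \<delta> where \<delta>: "\<delta> > 0" "\<And>t. \<bar>t - s\<bar> < \<delta> \<Longrightarrow> cmod (a t - a s) < cmod (a s) / 2"
    unfolding continuous_at_eps_delta by (metis dist_norm dist_real_def)
  have "cmod (a s) / 2 \<le> cmod (a t)" if "\<bar>t - s\<bar> < \<delta>" for t
    using \<delta>(2)[OF that] norm_triangle_ineq2[of "a s" "a t"] by (simp add: norm_minus_commute)
  then show ?thesis
    using that[of \<delta> "cmod (a s) / 2"] \<delta>(1) nz by simp
qed

definition rational_enum :: "nat \<Rightarrow> real" where
  "rational_enum k = of_rat (nat_to_rat_surj k)"

lemma rational_enum_dense: "\<delta> > 0 \<Longrightarrow> \<exists>k. \<bar>rational_enum k - s\<bar> < \<delta>"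
proof -
  assume "\<delta> > 0"
  then obtain r where "s < of_rat r" "of_rat r < s + \<delta>"
    using of_rat_dense[of s "s + \<delta>"] by auto
  moreover obtain k where "nat_to_rat_surj k = r"
    using surj_nat_to_rat_surj by (metis surjD)
  ultimately show ?thesis
    by (intro exI[of _ k]) (simp add: rational_enum_def)
qed

lemma Cb_zero_on_rationals:
  assumes "a \<in> Cb" "\<And>k. a (rational_enum k) = 0"
  shows "a s = 0"
proof (rule ccontr)
  assume "a s \<noteq> 0"
  then obtain \<delta> c where "\<delta> > 0" "c > 0" "\<And>t. \<bar>t - s\<bar> < \<delta> \<Longrightarrow> c \<le> cmod (a t)"
    using Cb_nonzero_locally[OF assms(1)] by blast
  then show False
    using rational_enum_dense[of \<delta> s] assms(2) by (metis norm_zero not_le)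
qed

text \<open>
  A continuous function cannot be supported on one point, as the line has no isolated points.
\<close>

lemma Cb_zero_off_point:
  assumes "a \<in> Cb" "\<And>t. t \<noteq> p \<Longrightarrow> a t = 0"
  shows "a s = 0"
proof (rule ccontr)
  assume "a s \<noteq> 0"
  then obtain \<delta> c where "\<delta> > 0" "c > 0" and c: "\<And>t. \<bar>t - s\<bar> < \<delta> \<Longrightarrow> c \<le> cmod (a t)"
    using Cb_nonzero_locally[OF assms(1)] by blast
  have "s = p"
    using assms(2) \<open>a s \<noteq> 0\<close> by blast
  have "c \<le> cmod (a (s + \<delta> / 2))"
    using \<open>\<delta> > 0\<close> by (intro c) simp
  then show False
    using assms(2)[of "s + \<delta> / 2"] \<open>s = p\<close> \<open>\<delta> > 0\<close> \<open>c > 0\<close> by simp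
qed

section \<open>A functionally thick submodule that is not essential\<close>

definition rational_relation_submodule :: "(nat \<Rightarrow> real \<Rightarrow> complex) set" where
  "rational_relation_submodule = {x \<in> l2_sections. \<forall>k. x (Suc k) (rational_enum k) - (1/2)^k * x 0 (rational_enum k) = 0}"

lemma closed_rational_relation_submodule: "closed_submodule Cb_algebra l2_module rational_relation_submodule"
  unfolding rational_relation_submodule_def
proof (rule closed_submodule_kernel)
  fix i
  have "cmod (x (Suc i) (rational_enum i) - (1/2)^i * x 0 (rational_enum i)) \<le> 2 * l2_norm x"
    if x: "x \<in> l2_sections" for x
  proof -
    have "cmod (x (Suc i) (rational_enum i) - (1/2)^i * x 0 (rational_enum i)) \<le>
      cmod (x (Suc i) (rational_enum i)) + (1/2)^i * cmod (x 0 (rational_enum i))"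
      by (rule order_trans[OF norm_triangle_ineq4]) (simp add: norm_mult norm_power)
    also have "\<dots> \<le> l2_norm x + 1 * l2_norm x"
      using x by (intro add_mono mult_mono coordinate_le_l2_norm power_le_one) auto
    finally show ?thesis
      by simp
  qed
  then show "\<exists>B. \<forall>x\<in>l2_sections. cmod (x (Suc i) (rational_enum i) - (1/2)^i * x 0 (rational_enum i)) \<le> B * l2_norm x"
    by blast
qed (auto simp: algebra_simps)

lemma l2_sectionsI_dominated:
  assumes x: "\<And>k. x k \<in> Cb" and le: "\<And>k s. cmod (x k s) \<le> b k" and b: "summable (\<lambda>k. (b k)\<^sup>2)"
  shows "x \<in> l2_sections"
  unfolding l2_sections_def
proof (intro CollectI conjI allI impI x)
  fix \<epsilon> :: real assume "\<epsilon> > 0"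
  then obtain n where n: "\<And>m. norm (\<Sum>k=n..<m. (b k)\<^sup>2) < \<epsilon>"
    using b unfolding summable_Cauchy by (meson order_refl)
  have "(\<Sum>k=n..<m. (cmod (x k s))\<^sup>2) \<le> \<epsilon>" for m s
  proof -
    have "(\<Sum>k=n..<m. (cmod (x k s))\<^sup>2) \<le> (\<Sum>k=n..<m. (b k)\<^sup>2)"
      using le by (intro sum_mono power_mono) auto
    then show ?thesis
      using n[of m] by simp
  qed
  then show "\<exists>n. \<forall>m s. (\<Sum>k=n..<m. (cmod (x k s))\<^sup>2) \<le> \<epsilon>"
    by blast
qed

text \<open>
  The element \<open>e\<^sub>0 + \<Sum>\<^sub>k 2\<^sup>-\<^sup>k e\<^bsub>k+1\<^esub>\<close> of the submodule. The weights \<open>2\<^sup>-\<^sup>k\<close> in the defining relations are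
  chosen so that this constant solution is square summable.
\<close>

definition geometric_section :: "nat \<Rightarrow> real \<Rightarrow> complex" where
  "geometric_section k s = (if k = 0 then 1 else (1/2)^(k - 1))"

lemma geometric_section_mem: "geometric_section \<in> rational_relation_submodule"
proof -
  have "summable (\<lambda>k. (2 * (1/2)^k :: real)\<^sup>2)"
  proof -
    have "(2 * (1/2)^k :: real)\<^sup>2 = 4 * (1/4)^k" for k
      by (simp add: power2_eq_square power_mult_distrib[symmetric])
    then show ?thesis
      by (simp add: summable_mult summable_geometric)
  qed
  moreover have "cmod (geometric_section k s) \<le> 2 * (1/2)^k" for k s
    by (cases k) (auto simp: geometric_section_def norm_power norm_divide)
  ultimately have "geometric_section \<in> l2_sections"
    by (intro l2_sectionsI_dominated[of _ "\<lambda>k. 2 * (1/2)^k"]) (auto simp: geometric_section_def[abs_def])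
  then show ?thesis
    by (simp add: rational_relation_submodule_def geometric_section_def)
qed

lemma coord_one_scale: "(\<lambda>k s. a s * coord j (\<lambda>s. 1) k s) = coord j a"
  by (auto simp: coord_def fun_eq_iff)

theorem rational_relation_submodule_functionally_thick:
  "functionally_thick Cb_algebra l2_module rational_relation_submodule"
  unfolding functionally_thick_def
proof (intro allI impI ballI)
  fix f x
  assume "mod_functional Cb_algebra l2_module f \<and> (\<forall>m\<in>rational_relation_submodule. f m = \<zero>\<^bsub>Cb_algebra\<^esub>)"
  then have f: "mod_functional Cb_algebra l2_module f" and fM: "\<And>m. m \<in> rational_relation_submodule \<Longrightarrow> f m = 0"
    by auto
  note fs = l2_functional_simps[OF f]
  let ?e = "\<lambda>k. coord k (\<lambda>s. 1)"
  have e: "?e k \<in> l2_sections" for k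
    by (rule coord_mem) simp
  have e_Suc: "f (?e (Suc j)) s = 0" for j s
  proof (rule Cb_zero_off_point)
    show "f (?e (Suc j)) \<in> Cb"
      using fs(1) e by blast
    fix t assume t: "t \<noteq> rational_enum j"
    \<comment> \<open>multiplying \<open>?e (Suc j)\<close> by a function whose only zero is \<open>rational_enum j\<close> lands in the submodule\<close>
    define a where "a s = complex_of_real (min 1 \<bar>s - rational_enum j\<bar>)" for s
    have "a \<in> Cb"
    proof (rule CbI)
      show "continuous_on UNIV a"
        unfolding a_def by (intro continuous_intros)
      show "cmod (a s) \<le> 1" for s
        by (simp add: a_def)
    qed
    have "coord (Suc j) a \<in> rational_relation_submodule"
      using coord_mem[OF \<open>a \<in> Cb\<close>] by (auto simp: rational_relation_submodule_def coord_def a_def)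
    then have "cnj (a t) * f (?e (Suc j)) t = 0"
      using fs(3)[OF e \<open>a \<in> Cb\<close>, of "Suc j" t] fM by (simp add: coord_one_scale)
    then show "f (?e (Suc j)) t = 0"
      using t by (auto simp: a_def min_def split: if_splits)
  qed
  have e_0: "f (?e 0) s = 0" for s
  proof -
    have g: "geometric_section \<in> l2_sections"
      using geometric_section_mem by (simp add: rational_relation_submodule_def)
    have "(\<lambda>k. cnj (geometric_section k s) * f (?e k) s) sums f geometric_section s"
      by (rule functional_expansion[OF f g])
    moreover have "(\<lambda>k. cnj (geometric_section k s) * f (?e k) s) = (\<lambda>k. if k = 0 then f (?e 0) s else 0)"
    proof
      show "cnj (geometric_section k s) * f (?e k) s = (if k = 0 then f (?e 0) s else 0)" for k
        using e_Suc by (cases k) (auto simp: geometric_section_def)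
    qed
    ultimately have "f (?e 0) s = f geometric_section s"
      using sums_single[of 0 "\<lambda>k. f (?e 0) s"] sums_unique2 by (simp cong: if_cong)
    then show ?thesis
      using fM[OF geometric_section_mem] by simp
  qed
  assume "x \<in> carrier l2_module"
  then have x: "x \<in> l2_sections"
    by simp
  have "f x s = 0" for s
  proof -
    have "f (?e k) s = 0" for k
      using e_0 e_Suc by (cases k) auto
    then show ?thesis
      using functional_expansion[OF f x, of s] by (simp add: sums_0 sums_unique2[OF _ sums_zero])
  qed
  then show "f x = \<zero>\<^bsub>Cb_algebra\<^esub>"
    by (simp add: fun_eq_iff)
qed

theorem rational_relation_submodule_not_essential: "\<not> essential Cb_algebra l2_module rational_relation_submodule"
proof
  assume ess: "essential Cb_algebra l2_module rational_relation_submodule"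
  define K where "K = {x \<in> l2_sections. \<forall>k. x (Suc k) = 0}"
  have "submodule K complex_ring l2_module"
    by (intro submodule_complexI l2.vector_space)
      (auto simp: K_def l2_sections_zero l2_sections_add l2_sections_smult fun_eq_iff)
  then have "mod_submodule Cb_algebra l2_module K"
    by (auto simp: mod_submodule_def K_def l2_sections_scale fun_eq_iff)
  moreover have "coord 0 (\<lambda>s. 1) \<in> K"
    by (simp add: K_def coord_mem) (simp add: coord_def fun_eq_iff)
  moreover have "coord 0 (\<lambda>s. 1) \<noteq> 0"
    by (auto simp: coord_def fun_eq_iff)
  ultimately have "rational_relation_submodule \<inter> K \<noteq> {0}"
    using ess by (auto simp: essential_def)
  moreover have "x = 0" if "x \<in> rational_relation_submodule" "x \<in> K" for x
  proof -
    have "x 0 s = 0" for s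
    proof (rule Cb_zero_on_rationals)
      show "x 0 \<in> Cb"
        using that by (simp add: K_def l2_sections_coordinate)
      show "x 0 (rational_enum k) = 0" for k
        using that by (simp add: K_def rational_relation_submodule_def)
    qed
    then have "x k s = 0" for k s
      using that by (cases k) (auto simp: K_def)
    then show ?thesis
      by (simp add: fun_eq_iff)
  qed
  moreover have "0 \<in> rational_relation_submodule" "0 \<in> K"
    by (simp_all add: rational_relation_submodule_def K_def l2_sections_zero)
  ultimately show False
    by blast
qed

section \<open>A thick submodule that is not functionally thick\<close>

text \<open>
  An increasing sequence of continuous functions with limit \<open>\<Sum>\<^sub>i 2\<^sup>-\<^sup>i 1\<^bsub>t \<noteq> q\<^sub>i\<^esub>\<close>. The limit jumps at every
  rational, so the convergence is uniform on no interval. Truncating the sum at \<open>n\<close> as well avoids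
  infinite sums of functions.
\<close>

definition step_sum :: "nat \<Rightarrow> real \<Rightarrow> real" where
  "step_sum n t = (\<Sum>i<n. (1/2)^i * min 1 (real n * \<bar>t - rational_enum i\<bar>))"

lemma step_sum_continuous: "continuous_on UNIV (step_sum n)"
  unfolding step_sum_def[abs_def] by (intro continuous_intros)

lemma step_sum_0: "step_sum 0 t = 0"
  by (simp add: step_sum_def)

lemma step_sum_le: "step_sum n t \<le> 2"
proof -
  have "step_sum n t \<le> (\<Sum>i<n. (1/2)^i * 1)"
    unfolding step_sum_def by (intro sum_mono mult_left_mono) auto
  also have "\<dots> = 2 - 2 * (1/2)^n"
    by (induction n) auto
  also have "\<dots> \<le> 2"
    by simp
  finally show ?thesis .
qed

lemma step_sum_diff_ge:
  assumes "n \<le> m"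
  shows "(\<Sum>i<n. (1/2)^i * (min 1 (real m * \<bar>t - rational_enum i\<bar>) - min 1 (real n * \<bar>t - rational_enum i\<bar>)))
    \<le> step_sum m t - step_sum n t"
proof -
  have "(\<Sum>i<n. (1/2)^i * min 1 (real m * \<bar>t - rational_enum i\<bar>)) \<le> step_sum m t"
    unfolding step_sum_def using assms by (intro sum_mono2) auto
  then show ?thesis
    by (simp add: step_sum_def right_diff_distrib sum_subtractf)
qed

lemma step_sum_increment_nonneg:
  assumes "n \<le> m"
  shows "0 \<le> (1/2)^i * (min 1 (real m * \<bar>t\<bar>) - min 1 (real n * \<bar>t\<bar>))"
  using mult_right_mono[of "real n" "real m" "\<bar>t\<bar>"] assms by (intro mult_nonneg_nonneg) (auto simp: min_def)

lemma step_sum_mono: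
  assumes "n \<le> m"
  shows "step_sum n t \<le> step_sum m t"
proof -
  have "0 \<le> (\<Sum>i<n. (1/2)^i * (min 1 (real m * \<bar>t - rational_enum i\<bar>) - min 1 (real n * \<bar>t - rational_enum i\<bar>)))"
    by (intro sum_nonneg step_sum_increment_nonneg assms)
  then show ?thesis
    using step_sum_diff_ge[OF assms, of t] by linarith
qed

text \<open>
  Near \<open>q\<^sub>i\<close>, but not at it, the \<open>i\<close>-th summand of \<open>step_sum n\<close> is still small and that of \<open>step_sum m\<close>
  has reached its limit, while the other summands only increase from \<open>n\<close> to \<open>m\<close>.
\<close>

lemma step_sum_jump:
  assumes i: "i < n" "n \<le> m"
    and small: "real n * \<bar>t - rational_enum i\<bar> \<le> 1/2" and large: "1 \<le> real m * \<bar>t - rational_enum i\<bar>"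
  shows "(1/2)^i / 2 \<le> step_sum m t - step_sum n t"
proof -
  let ?d = "\<lambda>i. (1/2)^i * (min 1 (real m * \<bar>t - rational_enum i\<bar>) - min 1 (real n * \<bar>t - rational_enum i\<bar>))"
  have "(1/2)^i * (1/2) \<le> ?d i"
    using small large by (intro mult_left_mono) auto
  also have "\<dots> \<le> (\<Sum>i<n. ?d i)"
    using i step_sum_increment_nonneg by (intro member_le_sum) auto
  also have "\<dots> \<le> step_sum m t - step_sum n t"
    using i by (intro step_sum_diff_ge)
  finally show ?thesis
    by simp
qed

text \<open>
  The squares of the coordinates from index \<open>1\<close> on are the increments of \<^const>\<open>step_sum\<close>. The
  coordinate \<open>1\<close> at index \<open>0\<close> makes the orthogonal complement of the kernel computable.
\<close>

definition weak_section :: "nat \<Rightarrow> real \<Rightarrow> complex" where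
  "weak_section k t = (case k of 0 \<Rightarrow> 1 | Suc n \<Rightarrow> of_real (sqrt (step_sum (Suc n) t - step_sum n t)))"

lemma weak_section_sum:
  "n \<le> m \<Longrightarrow> (\<Sum>k=Suc n..<Suc m. (cmod (weak_section k t))\<^sup>2) = step_sum m t - step_sum n t"
proof (induction m rule: dec_induct)
  case (step m)
  have "(cmod (weak_section (Suc m) t))\<^sup>2 = step_sum (Suc m) t - step_sum m t"
    using step_sum_mono[of m "Suc m" t] by (simp add: weak_section_def)
  then show ?case
    using step by simp
qed simp

lemma weak_section_bounded: "l2_bounded weak_section (2\<^sup>2)"
  unfolding l2_bounded_def
proof (intro allI)
  fix m t
  show "(\<Sum>k<m. (cmod (weak_section k t))\<^sup>2) \<le> 2\<^sup>2"
  proof (cases m)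
    case (Suc n)
    have "(\<Sum>k<Suc n. (cmod (weak_section k t))\<^sup>2) =
      (cmod (weak_section 0 t))\<^sup>2 + (\<Sum>k=Suc 0..<Suc n. (cmod (weak_section k t))\<^sup>2)"
      by (simp add: sum.atLeast_Suc_lessThan lessThan_atLeast0)
    also have "\<dots> = 1 + (step_sum n t - step_sum 0 t)"
      by (subst weak_section_sum) (simp_all add: weak_section_def)
    also have "\<dots> \<le> 2\<^sup>2"
      using step_sum_le[of n t] by (simp add: step_sum_0)
    finally show ?thesis
      using Suc by simp
  qed simp
qed

lemma weak_section_coordinate: "weak_section k \<in> Cb"
proof (rule CbI)
  show "cmod (weak_section k s) \<le> 2" for s
    by (rule l2_bounded_coordinate[OF weak_section_bounded]) simp
  show "continuous_on UNIV (weak_section k)"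
  proof (cases k)
    case (Suc n)
    have "continuous_on UNIV (\<lambda>t. complex_of_real (sqrt (step_sum (Suc n) t - step_sum n t)))"
      by (intro continuous_intros step_sum_continuous)
    then show ?thesis
      by (simp add: Suc weak_section_def[abs_def])
  qed (simp add: weak_section_def[abs_def])
qed

lemma cnj_weak_section: "cnj (weak_section k t) = weak_section k t"
  by (simp add: weak_section_def split: nat.split)

text \<open>
  Where \<open>a\<close> is bounded away from zero the tails of \<open>\<Sum>\<^sub>k \<bar>v\<^sub>k\<bar>\<^sup>2\<close> would have to be uniformly small,
  but the jump at a rational \<open>q\<^sub>i\<close> nearby keeps them above \<open>2\<^sup>-\<^sup>i / 2\<close>.
\<close>

lemma multiple_of_weak_section_zero:
  assumes a: "a \<in> Cb" and mem: "(\<lambda>k t. a t * weak_section k t) \<in> l2_sections"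
  shows "a s = 0"
proof (rule ccontr)
  assume "a s \<noteq> 0"
  then obtain \<delta> c where "\<delta> > 0" "c > 0" and c: "\<And>t. \<bar>t - s\<bar> < \<delta> \<Longrightarrow> c \<le> cmod (a t)"
    using Cb_nonzero_locally[OF a] by blast
  obtain i where i: "\<bar>rational_enum i - s\<bar> < \<delta> / 2"
    using rational_enum_dense[of "\<delta> / 2" s] \<open>\<delta> > 0\<close> by auto
  \<comment> \<open>half of the lower bound \<open>c\<^sup>2 * (1/2)^i / 2\<close> that the jump at \<open>rational_enum i\<close> gives for the tails\<close>
  define \<epsilon> where "\<epsilon> = c\<^sup>2 * (1/2)^i / 4"
  have "\<epsilon> > 0"
    using \<open>c > 0\<close> by (simp add: \<epsilon>_def)
  then obtain n0 where n0: "\<And>m t. (\<Sum>k=n0..<m. (cmod (a t * weak_section k t))\<^sup>2) \<le> \<epsilon>"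
    using mem unfolding l2_sections_def by blast
  define n where "n = Suc (max n0 i)"
  \<comment> \<open>so close to \<open>rational_enum i\<close> that its summand in \<open>step_sum n\<close> is at most one half\<close>
  define r where "r = min (\<delta> / 4) (1 / (2 * real n))"
  define t where "t = rational_enum i + r"
  have "r > 0" "real n * r \<le> 1/2"
    using \<open>\<delta> > 0\<close> by (auto simp: r_def n_def min_def field_simps)
  obtain m0 :: nat where "1 / r \<le> real m0"
    using real_arch_simple by blast
  define m where "m = max n m0"
  have "1 \<le> real m0 * r"
    using \<open>1 / r \<le> real m0\<close> \<open>r > 0\<close> by (simp add: field_simps)
  also have "\<dots> \<le> real m * r"
    using \<open>r > 0\<close> by (intro mult_right_mono) (auto simp: m_def)
  finally have "1 \<le> real m * r" .
  have jump: "(1/2)^i / 2 \<le> step_sum m t - step_sum n t"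
  proof (rule step_sum_jump)
    show "i < n" "n \<le> m"
      by (auto simp: n_def m_def)
    show "real n * \<bar>t - rational_enum i\<bar> \<le> 1/2" "1 \<le> real m * \<bar>t - rational_enum i\<bar>"
      using \<open>r > 0\<close> \<open>real n * r \<le> 1/2\<close> \<open>1 \<le> real m * r\<close> by (simp_all add: t_def)
  qed
  have "\<bar>t - s\<bar> < \<delta>"
  proof -
    have "r \<le> \<delta> / 4"
      by (simp add: r_def)
    then show ?thesis
      using i \<open>r > 0\<close> \<open>\<delta> > 0\<close> unfolding t_def by linarith
  qed
  have "c\<^sup>2 * ((1/2)^i / 2) \<le> (cmod (a t))\<^sup>2 * (step_sum m t - step_sum n t)"
    using c[OF \<open>\<bar>t - s\<bar> < \<delta>\<close>] jump \<open>c > 0\<close> by (intro mult_mono power_mono) auto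
  also have "\<dots> = (\<Sum>k=Suc n..<Suc m. (cmod (a t * weak_section k t))\<^sup>2)"
    by (subst weak_section_sum[symmetric])
      (simp_all add: m_def norm_mult power_mult_distrib sum_distrib_left del: sum.op_ivl_Suc)
  also have "\<dots> \<le> (\<Sum>k=n0..<Suc m. (cmod (a t * weak_section k t))\<^sup>2)"
    by (rule sum_mono2) (auto simp: n_def)
  also have "\<dots> \<le> \<epsilon>"
    by (rule n0)
  finally show False
    using \<open>\<epsilon> > 0\<close> by (simp add: \<epsilon>_def)
qed

definition weak_kernel :: "(nat \<Rightarrow> real \<Rightarrow> complex) set" where
  "weak_kernel = {x \<in> l2_sections. \<forall>t. pairing weak_section x t = 0}"

lemma pairing_weak_section_le:
  "x \<in> l2_sections \<Longrightarrow> cmod (pairing weak_section x t) \<le> 2 * l2_norm x"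
  using norm_pairing_le[OF weak_section_bounded _ l2_norm_bound] l2_norm_nonneg by simp

lemma closed_weak_kernel: "closed_submodule Cb_algebra l2_module weak_kernel"
  unfolding weak_kernel_def
proof (rule closed_submodule_kernel)
  fix t x y a
  assume x: "x \<in> l2_sections"
  show "pairing weak_section (\<lambda>k s. a s * x k s) t = a t * pairing weak_section x t"
    by (rule pairing_scale_right[OF weak_section_bounded l2_norm_bound[OF x]])
  assume y: "y \<in> l2_sections"
  show "pairing weak_section (x + y) t = pairing weak_section x t + pairing weak_section y t"
    by (rule pairing_add_right[OF weak_section_bounded l2_norm_bound[OF x] l2_norm_bound[OF y]])
qed (use pairing_weak_section_le in blast)

lemma weak_functional: "mod_functional Cb_algebra l2_module (\<lambda>x s. cnj (pairing weak_section x s))"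
  unfolding mod_functional_def
proof (intro conjI ballI allI)
  have mem: "(\<lambda>s. cnj (pairing weak_section x s)) \<in> Cb" if "x \<in> l2_sections" for x
    using pairing_mem_Cb[OF weak_section_coordinate weak_section_bounded _ that] by simp
  fix x y a t
  assume "x \<in> carrier l2_module"
  then have x: "x \<in> l2_sections"
    by simp
  note scale = pairing_scale_right[OF weak_section_bounded l2_norm_bound[OF x]]
  show "(\<lambda>s. cnj (pairing weak_section x s)) \<in> carrier Cb_algebra"
    using mem x by simp
  show "(\<lambda>s. cnj (pairing weak_section (t \<odot>\<^bsub>l2_module\<^esub> x) s)) =
    cnj t \<odot>\<^bsub>Cb_algebra\<^esub> (\<lambda>s. cnj (pairing weak_section x s))"
    using scale[of "\<lambda>s. t"] by simp
  show "(\<lambda>s. cnj (pairing weak_section (act l2_module x a) s)) =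
    star Cb_algebra a \<otimes>\<^bsub>Cb_algebra\<^esub> (\<lambda>s. cnj (pairing weak_section x s))"
    by (simp add: scale fun_eq_iff)
  assume "y \<in> carrier l2_module"
  then have y: "y \<in> l2_sections"
    by simp
  show "(\<lambda>s. cnj (pairing weak_section (x \<oplus>\<^bsub>l2_module\<^esub> y) s)) =
    (\<lambda>s. cnj (pairing weak_section x s)) \<oplus>\<^bsub>Cb_algebra\<^esub> (\<lambda>s. cnj (pairing weak_section y s))"
    using x y mem pairing_add_right[OF weak_section_bounded l2_norm_bound[OF x] l2_norm_bound[OF y]]
    by (simp add: fun_eq_iff)
next
  have "cnorm Cb_algebra (\<lambda>s. cnj (pairing weak_section x s)) \<le> 2 * l2_norm x" if x: "x \<in> l2_sections" for x
    using sup_norm_le_iff[OF pairing_mem_Cb[OF weak_section_coordinate weak_section_bounded _ x]]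
      pairing_weak_section_le[OF x] by simp
  then show "\<exists>C. \<forall>x\<in>carrier l2_module. cnorm Cb_algebra (\<lambda>s. cnj (pairing weak_section x s)) \<le> C * l2_norm x"
    by auto
qed

lemma pairing_coord: "pairing v (coord j a) s = cnj (v j s) * a s"
proof -
  have "(\<lambda>k. cnj (v k s) * coord j a k s) = (\<lambda>k. if k = j then cnj (v j s) * a s else 0)"
    by (auto simp: coord_def)
  then have "(\<lambda>k. cnj (v k s) * coord j a k s) sums (cnj (v j s) * a s)"
    using sums_single[of j "\<lambda>k. cnj (v j s) * a s"] by simp
  then show ?thesis
    unfolding pairing_def by (rule sums_unique[symmetric])
qed

theorem weak_kernel_thick: "thick Cb_algebra l2_module weak_kernel"
  unfolding thick_def
proof (intro equalityI subsetI)
  fix y assume "y \<in> ortho_compl Cb_algebra l2_module weak_kernel"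
  then have y: "y \<in> l2_sections" and orth: "\<And>m. m \<in> weak_kernel \<Longrightarrow> pairing y m = 0"
    by (auto simp: ortho_compl_def)
  have y_eq: "y k s = y 0 s * weak_section k s" for k s
  proof -
    \<comment> \<open>the element \<open>e\<^sub>k - e\<^sub>0 v\<^sub>k\<close> of the kernel; for \<open>k = 0\<close> it is zero\<close>
    let ?m = "coord k (\<lambda>s. 1) + coord 0 (\<lambda>s. - weak_section k s)"
    have mem: "coord k (\<lambda>s. 1) \<in> l2_sections" "coord 0 (\<lambda>s. - weak_section k s) \<in> l2_sections"
      using Cb_closed(3)[OF weak_section_coordinate, of "-1" k] by (auto intro: coord_mem)
    have pair: "pairing v ?m s = cnj (v k s) - cnj (v 0 s) * weak_section k s" if "l2_bounded v B" for v B s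
      by (subst pairing_add_right[OF that mem[THEN l2_norm_bound]]) (simp add: pairing_coord)
    have "pairing weak_section ?m s = 0" for s
      unfolding pair[OF weak_section_bounded] by (simp add: cnj_weak_section) (simp add: weak_section_def)
    then have "?m \<in> weak_kernel"
      using l2_sections_add[OF mem] by (simp add: weak_kernel_def)
    then have "pairing y ?m s = 0"
      using orth by simp
    then have "cnj (y k s) = cnj (y 0 s) * weak_section k s"
      unfolding pair[OF l2_norm_bound[OF y]] by simp
    then have "cnj (y k s) = cnj (y 0 s * weak_section k s)"
      by (simp add: cnj_weak_section)
    then show ?thesis
      by (simp only: complex_cnj_cancel_iff)
  qed
  have "(\<lambda>k t. y 0 t * weak_section k t) = y"
    by (intro ext) (rule y_eq[symmetric])
  then have "(\<lambda>k t. y 0 t * weak_section k t) \<in> l2_sections"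
    using y by simp
  then have "y 0 s = 0" for s
    using multiple_of_weak_section_zero[OF l2_sections_coordinate[OF y]] by blast
  then have "y k s = 0" for k s
    using y_eq[of k s] by simp
  then show "y \<in> {\<zero>\<^bsub>l2_module\<^esub>}"
    by (simp add: fun_eq_iff)
next
  fix y assume "y \<in> {\<zero>\<^bsub>l2_module\<^esub>}"
  then have "y = 0"
    by simp
  moreover have "pairing 0 m = 0" for m
    by (simp add: pairing_def fun_eq_iff)
  ultimately show "y \<in> ortho_compl Cb_algebra l2_module weak_kernel"
    by (simp add: ortho_compl_def l2_sections_zero)
qed

theorem weak_kernel_not_functionally_thick: "\<not> functionally_thick Cb_algebra l2_module weak_kernel"
proof
  assume thick: "functionally_thick Cb_algebra l2_module weak_kernel"
  have e: "coord 0 (\<lambda>s. 1) \<in> l2_sections"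
    by (rule coord_mem) simp
  have "\<forall>m\<in>weak_kernel. (\<lambda>s. cnj (pairing weak_section m s)) = \<zero>\<^bsub>Cb_algebra\<^esub>"
    by (simp add: weak_kernel_def fun_eq_iff)
  then have "(\<lambda>s. cnj (pairing weak_section (coord 0 (\<lambda>s. 1)) s)) = \<zero>\<^bsub>Cb_algebra\<^esub>"
    using thick weak_functional e unfolding functionally_thick_def by auto
  then show False
    by (simp add: pairing_coord fun_eq_iff weak_section_def)
qed

theorem theorem4p1:
  shows "(\<forall>(A :: 'a cstar_alg) (N :: ('a, 'n) hilbert_mod) M.
            hilbert_module A N \<and> closed_submodule A N M \<longrightarrow>
              (essential A N M \<longrightarrow> functionally_thick A N M) \<and>
              (functionally_thick A N M \<longrightarrow> thick A N M)) \<and>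
         (\<exists>(A :: (real \<Rightarrow> complex) cstar_alg) (N :: (real \<Rightarrow> complex, nat \<Rightarrow> real \<Rightarrow> complex) hilbert_mod) M.
            hilbert_module A N \<and> closed_submodule A N M \<and>
            functionally_thick A N M \<and> \<not> essential A N M) \<and>
         (\<exists>(A :: (real \<Rightarrow> complex) cstar_alg) (N :: (real \<Rightarrow> complex, nat \<Rightarrow> real \<Rightarrow> complex) hilbert_mod) M.
            hilbert_module A N \<and> closed_submodule A N M \<and>
            thick A N M \<and> \<not> functionally_thick A N M)"
  using hilbert_module.essential_imp_functionally_thick hilbert_module.functionally_thick_imp_thick
    l2_hilbert_module closed_rational_relation_submodule rational_relation_submodule_functionally_thick
    rational_relation_submodule_not_essential closed_weak_kernel weak_kernel_thick weak_kernel_not_functionally_thick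
  unfolding closed_submodule_def by blast

end
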